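(* Let $k\ge \ell\ge 1$ be integers with $k+\ell\ge 6$. Let $D$ be a Hamiltonian digraph, and let $G$ be its underlying graph. If the minimum degree satisfies $\delta(G)\ge k+\ell-1$, then $D$ contains a member of $C(k,\ell)$.
   Context: All graphs and digraphs are finite and simple (no loops, no multiple edges or arcs), except that a digraph may contain a pair of opposite arcs $(u,v),(v,u)$. The length of a directed path is its number of arcs. For positive integers $k,\ell$, the family $C(k,\ell)$ consists of all digraphs obtained from two internally vertex-disjoint directed paths, of lengths at least $k$ and at least $\ell$ respectively, by identifying their initial vertices and identifying their terminal vertices (so a member consists of two internally vertex-disjoint directed paths from a vertex $s$ to a vertex $t\ne s$, one of length at least $k$ and the other of length at least $\ell$). "$D$ contains a member" means as a subdigraph. A digraph is Hamiltonian if it contains a directed Hamiltonian cycle. The underlying graph of a digraph $D$ is the simple graph on $V(D)$ in which two vertices are adjacent whenever they are joined by at least one arc of $D$. *)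

theory Defs
  imports "Graph_Theory.Graph_Theory"
begin

definition (in pre_digraph) hamiltonian :: bool where
  "hamiltonian \<longleftrightarrow> (\<exists>p. cycle p \<and> tail G ` set p = verts G)"

text \<open>
  Undirected graphs are symmetric digraphs, as elsewhere in the library; in a graph without
  parallel arcs the degree of a vertex is then its out-degree. As a \<^const>\<open>Min\<close>, the minimum
  degree is only meaningful for finite graphs with at least one vertex.
\<close>
definition min_degree :: "('a, 'b) pre_digraph \<Rightarrow> nat" where
  "min_degree G = Min (out_degree G ` verts G)"

text \<open>
  The family \<open>C(k, l)\<close>. Disjointness of the arc sets is implied by internal
  vertex-disjointness except when both paths consist of a single arc; it rules out counting
  one and the same arc as two paths (which would only matter for \<open>k = l = 1\<close>).
\<close>
definition C_family :: "nat \<Rightarrow> nat \<Rightarrow> ('a, 'b) pre_digraph set" where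
  "C_family k l = {H. digraph H \<and>
     (\<exists>s t p q. s \<noteq> t
        \<and> pre_digraph.apath H s p t \<and> k \<le> length p
        \<and> pre_digraph.apath H s q t \<and> l \<le> length q
        \<and> set (pre_digraph.inner_verts H p) \<inter> set (pre_digraph.inner_verts H q) = {}
        \<and> set p \<inter> set q = {}
        \<and> verts H = set (pre_digraph.awalk_verts H s p) \<union> set (pre_digraph.awalk_verts H s q)
        \<and> arcs H = set p \<union> set q)}"

end

theory Submission
  imports Defs
begin

text \<open>
  Fix a Hamiltonian cycle and assume that there is no member of \<open>C(k, l)\<close>. Two crossing chords,
  or three chords in a suitable position, together with segments of the cycle form two internally
  disjoint paths, so they are excluded whenever the segments are long enough. The degree condition
  says that a vertex misses at most \<open>n - k - l\<close> others, so a vertex near the end of a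
  shortest chord (of span more than \<open>l\<close>) has about as many neighbours as the exclusions
  allow; the chords it is then forced to have exclude each other. This settles large \<open>n\<close>,
  separately for \<open>l = 1\<close>, \<open>k = l\<close>, \<open>k = l + 1\<close> and \<open>k > l + 1\<close>.
  If \<open>n = k + l\<close>, or \<open>n = k + l + 1\<close> and \<open>k > l + 1\<close>, the underlying graph is
  complete or misses a matching. If an arc skips a
  vertex of the cycle, that vertex can be moved elsewhere in the cycle, and the new Hamiltonian
  cycle has excluded chords. Hence no arc skips just one vertex, so all chords of span 2 point backwards,
  and a segment of the cycle can be traversed backwards, visiting all of its vertices; together
  with the complementary segment this gives the two paths.
\<close>

section \<open>Hamiltonian cycles without a pair of long paths\<close>

text \<open>There is no slack in the counting: the exclusions usually leave just
  \<open>k + l - 1\<close> possible neighbours of a well chosen vertex, or one more, so all of them,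
  or all but one, must occur, often in a prescribed direction. A backward arc of span
  \<open>s\<close> is also a forward arc of span \<open>n - s\<close>, so a chord can be used as
  jumping over either of its two sides, and minimality restricts both spans. Two internally disjoint
  paths of lengths \<open>k\<close> and \<open>l\<close> have \<open>k + l\<close> vertices
  together. If \<open>n = k + l\<close> they visit every vertex, and crossing chords, which leave
  out parts of the cycle, are of little help; this is why paths through all vertices of a segment
  are needed there. A segment of \<open>m\<close> arcs can be traversed backwards by blocks of three
  and five arcs, hence for all \<open>m\<close> except 1, 2, 4 and 7. The pairs (7,1), (7,2), (7,4)
  and (4,2) for \<open>k\<close> and \<open>l\<close> thus remain for explicit paths.\<close>

definition two_paths :: "('v \<Rightarrow> 'v \<Rightarrow> bool) \<Rightarrow> int \<Rightarrow> int \<Rightarrow> bool" where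
  "two_paths A k l \<longleftrightarrow> (\<exists>xs ys. xs \<noteq> [] \<and> ys \<noteq> [] \<and> successively A xs \<and> successively A ys
     \<and> distinct xs \<and> distinct ys \<and> hd xs = hd ys \<and> last xs = last ys \<and> hd xs \<noteq> last xs
     \<and> set xs \<inter> set ys = {hd xs, last xs} \<and> k < int (length xs) \<and> l < int (length ys))"

lemma two_paths_converse: "two_paths (\<lambda>x y. A y x) k l \<Longrightarrow> two_paths A k l"
proof -
  assume "two_paths (\<lambda>x y. A y x) k l"
  then obtain xs ys where *: "xs \<noteq> []" "ys \<noteq> []" "successively (\<lambda>x y. A y x) xs" "successively (\<lambda>x y. A y x) ys"
    "distinct xs" "distinct ys" "hd xs = hd ys" "last xs = last ys" "hd xs \<noteq> last xs"
    "set xs \<inter> set ys = {hd xs, last xs}" "k < int (length xs)" "l < int (length ys)"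
    unfolding two_paths_def by blast
  show ?thesis unfolding two_paths_def
    apply (rule exI[of _ "rev xs"], rule exI[of _ "rev ys"])
    using * by (auto simp: hd_rev last_rev)
qed

lemma two_paths_swap: "two_paths A l k \<Longrightarrow> two_paths A k l"
  unfolding two_paths_def by (metis Int_commute)

text \<open>The cycle is parametrised periodically by the integers, so that vertices near each other on
  it have positions that are close without reduction modulo \<open>n\<close>.\<close>

locale hcyc =
  fixes A :: "'v \<Rightarrow> 'v \<Rightarrow> bool" and V :: "'v set" and k l n :: int and c :: "int \<Rightarrow> 'v"
  assumes l1: "1 \<le> l" and lk: "l \<le> k" and kl6: "6 \<le> k + l"
    and AV: "A u v \<Longrightarrow> u \<in> V \<and> v \<in> V \<and> u \<noteq> v"
    and deg: "v \<in> V \<Longrightarrow> k + l - 1 \<le> int (card {u. A v u \<or> A u v})"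
    and nomem: "\<not> two_paths A k l"
    and n0: "0 < n"
    and per: "c (i + n) = c i"
    and bij: "bij_betw c {0..<n} V"
    and cyc: "A (c i) (c (i + 1))"
begin

definition E :: "int \<Rightarrow> int \<Rightarrow> bool" where "E i j \<longleftrightarrow> A (c i) (c j)"

definition adj :: "int \<Rightarrow> int \<Rightarrow> bool" where "adj i j \<longleftrightarrow> E i j \<or> E j i"

lemma adj_commute: "adj i j = adj j i" by (auto simp: adj_def)

lemma per_mult: "c (i + m * n) = c i" for m
proof -
  have *: "c (i + int p * n) = c i" for p i
  proof (induction p)
    case (Suc p) then show ?case using per[of "i + int p * n"] by (simp add: algebra_simps)
  qed simp
  show ?thesis
  proof (cases "0 \<le> m")
    case True then show ?thesis using *[of i "nat m"] by simp
  next
    case False then show ?thesis using *[of "i + m * n" "nat (- m)"] by simp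
  qed
qed

lemma c_mod: "c (i mod n) = c i"
  using per_mult[of "i mod n" "i div n"] by (simp add: algebra_simps)

lemma c_eq: "c i = c j \<longleftrightarrow> i mod n = j mod n"
proof
  assume "c i = c j"
  then have "c (i mod n) = c (j mod n)" by (simp add: c_mod)
  moreover have "inj_on c {0..<n}" using bij by (simp add: bij_betw_def)
  ultimately show "i mod n = j mod n" using n0 by (auto dest: inj_onD)
next
  assume "i mod n = j mod n" then show "c i = c j" by (metis c_mod)
qed

lemma c_window: "b \<le> i \<Longrightarrow> i < b + n \<Longrightarrow> b \<le> j \<Longrightarrow> j < b + n \<Longrightarrow> c i = c j \<Longrightarrow> i = j"
proof -
  assume *: "b \<le> i" "i < b + n" "b \<le> j" "j < b + n" "c i = c j"
  then have "n dvd i - j" by (simp add: c_eq mod_eq_dvd_iff)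
  moreover have "\<bar>i - j\<bar> < n" using * by auto
  ultimately have "\<not> 0 < \<bar>i - j\<bar>" by (metis dvd_abs_iff zdvd_not_zless)
  then show "i = j" by simp
qed

lemma cV: "c i \<in> V" using AV cyc by blast

lemma V_c: "v \<in> V \<Longrightarrow> \<exists>i. b \<le> i \<and> i < b + n \<and> v = c i"
proof -
  assume "v \<in> V"
  then obtain j where j: "v = c j" using bij unfolding bij_betw_def by blast
  have "c (b + (j - b) mod n) = c j" by (simp add: c_eq mod_add_right_eq)
  moreover have "0 \<le> (j - b) mod n" "(j - b) mod n < n" using n0 by auto
  ultimately show ?thesis by (intro exI[of _ "b + (j - b) mod n"]) (use j in auto)
qed

lemma E_per [simp]: "E (i + n) j = E i j" "E i (j + n) = E i j" "E (i - n) j = E i j" "E i (j - n) = E i j"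
  using per[of i] per[of j] per[of "i - n"] per[of "j - n"] by (auto simp: E_def)

lemma E_cyc [simp]: "E i (i + 1)" using cyc by (simp add: E_def)

lemma adj_per [simp]: "adj (i + n) j = adj i j" "adj i (j + n) = adj i j" "adj (i - n) j = adj i j" "adj i (j - n) = adj i j"
  by (auto simp: adj_def)

lemma hd_upto' [simp]: "a \<le> b \<Longrightarrow> hd [a..b::int] = a" by (simp add: upto_rec1)
lemma last_upto' [simp]: "a \<le> b \<Longrightarrow> last [a..b::int] = b" by (simp add: upto_rec2)

lemma succ_upto: "successively E [a..b]"
proof (induction "nat (b - a + 1)" arbitrary: a)
  case 0 then show ?case by simp
next
  case (Suc m)
  then have "a \<le> b" by simp
  then have "[a..b] = a # [a+1..b]" by (simp add: upto_rec1)
  moreover have "successively E [a+1..b]" using Suc by (intro Suc(1)) simp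
  ultimately show ?case by (cases "a + 1 \<le> b") (auto simp: successively_Cons)
qed

text \<open>Symmetric, because a configuration of chords does not determine which of its two paths
  is the longer one.\<close>

definition ok :: "int \<Rightarrow> int \<Rightarrow> bool" where "ok p q \<longleftrightarrow> k \<le> p \<and> l \<le> q \<or> l \<le> p \<and> k \<le> q"

text \<open>Positions in a window of length \<open>n\<close> are distinct vertices, so the two paths
  can be checked as lists of integers.\<close>

lemma config:
  assumes "successively E xs" "successively E ys" "distinct xs" "distinct ys"
    "xs \<noteq> []" "ys \<noteq> []" "hd xs = hd ys" "last xs = last ys" "hd xs \<noteq> last xs"
    "set xs \<inter> set ys \<subseteq> {hd xs, last xs}"
    and win: "\<forall>x\<in>set xs \<union> set ys. b \<le> x \<and> x < b + n"
    and ok: "ok p q" and len: "p < int (length xs)" "q < int (length ys)"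
  shows False
proof -
  have inj: "inj_on c (set xs \<union> set ys)" using c_window win by (intro inj_onI) blast
  have "successively A (map c xs)" "successively A (map c ys)"
    using assms(1,2) by (simp_all add: successively_map E_def[abs_def])
  moreover have "distinct (map c xs)" "distinct (map c ys)" using assms inj
    by (auto simp: distinct_map intro: inj_on_subset)
  moreover have "set (map c xs) \<inter> set (map c ys) = {hd (map c xs), last (map c xs)}"
  proof -
    have "set xs \<inter> set ys = {hd xs, last xs}"
      using assms hd_in_set[of xs] hd_in_set[of ys] last_in_set[of xs] last_in_set[of ys] by auto
    moreover have "c ` set xs \<inter> c ` set ys = c ` (set xs \<inter> set ys)"
      using inj_on_image_Int[OF inj, of "set xs" "set ys"] by auto
    ultimately show ?thesis using assms by (simp add: hd_map last_map)
  qed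
  moreover have "hd (map c xs) \<noteq> last (map c xs)"
    using assms inj_onD[OF inj, of "hd xs" "last xs"] by (auto simp: hd_map last_map)
  moreover have "hd (map c xs) = hd (map c ys)" "last (map c xs) = last (map c ys)"
    using assms by (simp_all add: hd_map last_map)
  ultimately have *: "two_paths A p q"
    unfolding two_paths_def using assms(5,6) len
    by (intro exI[of _ "map c xs"] exI[of _ "map c ys"]) simp
  have "two_paths A k l \<or> two_paths A l k" using * ok unfolding ok_def two_paths_def
    by (meson le_less_trans)
  then show False using nomem two_paths_swap by blast
qed

section \<open>Excluded configurations of chords\<close>

lemma succ_app: "successively E (xs @ ys) \<longleftrightarrow> successively E xs \<and> successively E ys \<and> (xs \<noteq> [] \<longrightarrow> ys \<noteq> [] \<longrightarrow> E (last xs) (hd ys))"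
  by (auto simp: successively_append_iff)

lemmas succ_simps = succ_app succ_upto successively_Cons

text \<open>Both paths run from \<open>a\<close> to \<open>d\<close>: one leaves the cycle at
  \<open>b\<close>, the other starts with the chord to \<open>m\<close>.\<close>

lemma cross1:
  assumes "E a m" "E b d" "a < b" "b < m" "m < d" "d < a + n" and ok: "ok (b - a + 1) (d - m + 1)"
  shows False
  by (rule config[of "[a..b] @ [d]" "[a] @ [m..d]" a, OF _ _ _ _ _ _ _ _ _ _ _ ok])
    (use assms(1-6) in \<open>auto simp: succ_simps\<close>)

text \<open>The same crossing seen from \<open>b\<close>: the cycle leads to \<open>m\<close>
  directly, and the chord to \<open>d\<close> leads there by way of \<open>a + n\<close>.\<close>

lemma cross2:
  assumes "E a m" "E b d" "a < b" "b < m" "m < d" "d \<le> a + n" and ok: "ok (m - b) (a + n - d + 2)"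
  shows False
  by (rule config[of "[b..m]" "[b] @ [d..a+n] @ [m]" b, OF _ _ _ _ _ _ _ _ _ _ _ ok])
    (use assms(1-6) E_per(1)[of a m] in \<open>auto simp: succ_simps simp del: E_per\<close>)

text \<open>The chord from \<open>x\<close> to \<open>y\<close> jumps over the segment from
  \<open>f\<close> to \<open>g\<close>; one path uses this chord, the other one the segment. The two
  letters in the name tell whether the chord at \<open>f\<close> and the chord at \<open>g\<close>
  point into or out of the segment.\<close>

lemma cross3_io:
  assumes "E x y" "E v f" "E g u" "v \<le> x" "x < f" "f \<le> g" "g < y" "y \<le> u" "u < v + n"
    and ok: "ok (x - v + 1 + u - y) (g - f + 2)"
  shows False
  by (rule config[of "[v..x] @ [y..u]" "[v] @ [f..g] @ [u]" v, OF _ _ _ _ _ _ _ _ _ _ _ ok])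
    (use assms(1-9) in \<open>auto simp: succ_simps\<close>)

lemma cross3_oo:
  assumes "E x y" "E f v" "E g u" "v \<le> x" "x < f" "f \<le> g" "g < y" "y \<le> u" "u < v + n"
    and ok: "ok (x - v + 2 + u - y) (g - f + 1)"
  shows False
  by (rule config[of "[f] @ [v..x] @ [y..u]" "[f..g] @ [u]" v, OF _ _ _ _ _ _ _ _ _ _ _ ok])
    (use assms(1-9) in \<open>auto simp: succ_simps\<close>)

lemma cross3_ii:
  assumes "E x y" "E v f" "E u g" "v \<le> x" "x < f" "f \<le> g" "g < y" "y \<le> u" "u < v + n"
    and ok: "ok (x - v + 2 + u - y) (g - f + 1)"
  shows False
  by (rule config[of "[v..x] @ [y..u] @ [g]" "[v] @ [f..g]" v, OF _ _ _ _ _ _ _ _ _ _ _ ok])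
    (use assms(1-9) in \<open>auto simp: succ_simps\<close>)

lemma cross3_oi:
  assumes "E x y" "E f v" "E u g" "v \<le> x" "x < f" "f < g" "g < y" "y \<le> u" "u < v + n"
    and ok: "ok (x - v + 3 + u - y) (g - f)"
  shows False
  by (rule config[of "[f] @ [v..x] @ [y..u] @ [g]" "[f..g]" v, OF _ _ _ _ _ _ _ _ _ _ _ ok])
    (use assms(1-9) in \<open>auto simp: succ_simps\<close>)

text \<open>Compared with the bounds given here, the four orientations gain 0 and 2, 1 and 1, or 2
  and 0 arcs on the two paths, so the directions at \<open>f\<close> and \<open>g\<close> may be
  ignored.\<close>

lemma cross3:
  assumes xy: "E x y" and vf: "adj v f" and gu: "adj g u" and o: "v \<le> x" "x < f" "f < g" "g < y" "y \<le> u" "u < v + n"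
    and ok: "ok (x - v + 1 + u - y) (g - f)"
  shows False
proof -
  have mono: "ok (x - v + 1 + u - y + i) (g - f + j)" if "0 \<le> i" "0 \<le> j" for i j
    using ok that by (auto simp: ok_def)
  show False
    using vf gu cross3_io[OF xy _ _ o(1-2) _ o(4-6)] cross3_oo[OF xy _ _ o(1-2) _ o(4-6)]
      cross3_ii[OF xy _ _ o(1-2) _ o(4-6)] cross3_oi[OF xy _ _ o]
      mono[of 0 2] mono[of 1 1] mono[of 2 0] o(3)
    by (auto simp: adj_def algebra_simps)
qed

text \<open>Either direction of the chord between \<open>f\<close> and \<open>u\<close> allows both
  \<open>cross1\<close> and \<open>cross2\<close>; an arc into \<open>f\<close> is taken to start at
  \<open>u - n\<close>.\<close>

lemma ban:
  assumes "E x y" "x < f" "f < y" "y < u" "u < x + n"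
  shows ban_o1: "E f u \<Longrightarrow> \<not> ok (f - x + 1) (u - y + 1)"
    and ban_o2: "E f u \<Longrightarrow> \<not> ok (y - f) (x + n - u + 2)"
    and ban_i1: "E u f \<Longrightarrow> \<not> ok (x + n - u + 1) (y - f + 1)"
    and ban_i2: "E u f \<Longrightarrow> \<not> ok (f - x) (u - y + 2)"
  using cross1[of x y f u] cross2[of x y f u] cross1[of "u - n" f x y] cross2[of "u - n" f x y] assms
  by (auto simp: algebra_simps)

section \<open>Counting neighbours by their offsets along the cycle\<close>

lemma degS:
  assumes "finite S" "\<And>f. 0 < f \<Longrightarrow> f < n \<Longrightarrow> adj i (i + f) \<Longrightarrow> f \<in> S"
  shows "k + l - 1 \<le> int (card S)"
proof -
  have "{u. A (c i) u \<or> A u (c i)} \<subseteq> (\<lambda>f. c (i + f)) ` S"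
  proof
    fix u assume u: "u \<in> {u. A (c i) u \<or> A u (c i)}"
    then have "u \<in> V" "u \<noteq> c i" using AV by auto
    then obtain j where j: "i \<le> j" "j < i + n" "u = c j" using V_c by blast
    then have "i < j" using \<open>u \<noteq> c i\<close> by (cases "i = j") auto
    moreover have "adj i (i + (j - i))" using u j by (auto simp: adj_def E_def)
    ultimately have "j - i \<in> S" using assms(2)[of "j - i"] j by auto
    then show "u \<in> (\<lambda>f. c (i + f)) ` S" using j by (auto intro!: image_eqI[of _ _ "j - i"])
  qed
  then have "card {u. A (c i) u \<or> A u (c i)} \<le> card S"
    using assms(1) by (meson card_image_le card_mono finite_imageI le_trans)
  then show ?thesis using deg[OF cV, of i] by linarith
qed

lemma n_ge: "k + l \<le> n"
proof -
  have "k + l - 1 \<le> int (card {1..n-1})" by (rule degS[of _ 0]) auto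
  then show ?thesis using n0 by (auto split: if_splits)
qed

text \<open>Reversing all arcs together with the sense of the cycle keeps spans and the distinction
  of forward and backward, but exchanges heads and tails: a result on the head of a chord yields one
  on its tail.\<close>

lemma mirror: "hcyc (\<lambda>x y. A y x) V k l n (\<lambda>i. c (- i))"
proof
  show "\<not> two_paths (\<lambda>x y. A y x) k l" using nomem two_paths_converse by blast
  show "c (- (i + n)) = c (- i)" for i using per[of "- i - n"] by simp
  show "A (c (- (i + 1))) (c (- i))" for i using cyc[of "- i - 1"] by simp
  show "k + l - 1 \<le> int (card {u. A u v \<or> A v u})" if "v \<in> V" for v
    using deg[OF that] by (simp add: disj_commute)
  have "(\<lambda>i. c (- i)) ` {0..<n} = V"
  proof safe
    fix v assume "v \<in> V"
    then obtain i where "1 - n \<le> i" "i < 1" "v = c i" using V_c[of v "1 - n"] by auto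
    then show "v \<in> (\<lambda>i. c (- i)) ` {0..<n}" by (intro image_eqI[of _ _ "- i"]) auto
  qed (use cV in auto)
  moreover have "inj_on (\<lambda>i. c (- i)) {0..<n}"
  proof (rule inj_onI)
    fix i j assume "i \<in> {0..<n}" "j \<in> {0..<n}" "c (- i) = c (- j)"
    then show "i = j" using c_window[of "1 - n" "- i" "- j"] by auto
  qed
  ultimately show "bij_betw (\<lambda>i. c (- i)) {0..<n} V"
    unfolding bij_betw_def by simp
qed (use l1 lk kl6 AV n0 in auto)

lemma mirror_E: "hcyc.E (\<lambda>x y. A y x) (\<lambda>i. c (- i)) i j = E (- j) (- i)"
  using hcyc.E_def[OF mirror] E_def by simp

lemma mirror_adj: "hcyc.adj (\<lambda>x y. A y x) (\<lambda>i. c (- i)) i j = adj (- j) (- i)"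
  using hcyc.adj_def[OF mirror] adj_def mirror_E by auto

end

lemma card_Un3: "int (card (A \<union> B \<union> C)) \<le> int (card A) + int (card B) + int (card C)"
  using card_Un_le[of "A \<union> B" C] card_Un_le[of A B] by linarith

lemma card_Un2: "int (card (A \<union> B)) \<le> int (card A) + int (card B)"
  using card_Un_le[of A B] by linarith

lemma card_two: "int (card {x, y}) \<le> 2"
  by (simp add: card_insert_if)

context hcyc begin

lemma deg_out: "finite S \<Longrightarrow> int (card S) < k + l - 1 \<Longrightarrow> \<exists>f. 0 < f \<and> f < n \<and> adj i (i + f) \<and> f \<notin> S"
  using degS[of S i] by fastforce

text \<open>At the vertex before the head, crossings with the chord exclude the offsets from
  \<open>k\<close> to \<open>n - l - 1\<close>. The other \<open>k + l - 1\<close> must all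
  occur.\<close>

lemma chord_Suc_l_adj:
  assumes E: "E i (i + l + 1)" and l2: "2 \<le> l" and n: "k + l + 1 \<le> n"
    and f: "1 \<le> f" "f < k"
  shows "adj (i + l) (i + l + f)"
proof (rule ccontr)
  assume no: "\<not> adj (i + l) (i + l + f)"
  have "f \<in> {1..k-1}" using f by auto
  then have "int (card (({1..k-1} - {f}) \<union> {n-l..n-1})) < k + l - 1"
    using card_Un2[of "{1..k-1} - {f}" "{n-l..n-1}"] l1 lk f by (simp add: card_Diff_singleton)
  then obtain g where g: "0 < g" "g < n" "adj (i + l) (i + l + g)" "g \<notin> ({1..k-1} - {f}) \<union> {n-l..n-1}"
    using deg_out[of "({1..k-1} - {f}) \<union> {n-l..n-1}" "i + l"] by blast
  then have "k \<le> g" "g < n - l" using no by (auto split: if_splits)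
  then show False
    using g(3) ban_o1[OF E, of "i + l" "i + l + g"] ban_i2[OF E, of "i + l" "i + l + g"] l2 lk
    by (auto simp: adj_def ok_def)
qed

text \<open>Saturation before the head gives an arc forward over \<open>k - 1\<close> positions, and
  by reflection \<open>i - 1\<close> and \<open>i + 1\<close> are adjacent. With the given chord
  these form a three chord configuration of lengths \<open>k\<close> and \<open>l + 1\<close>, or
  \<open>k + 1\<close> and \<open>l\<close>.\<close>

lemma no_chord_Suc_l:
  assumes l2: "2 \<le> l" and n: "k + l + 1 \<le> n"
  shows "\<not> E i (i + l + 1)"
proof
  assume E: "E i (i + l + 1)"
  have "adj (i + l) (i + l + (k - 1))" by (rule chord_Suc_l_adj[OF E l2 n]) (use lk kl6 l2 in auto)
  then have b: "E (i + l) (i + l + k - 1)"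
    using ban_i2[OF E, of "i + l" "i + l + k - 1"] l2 lk kl6 n
    by (auto simp: adj_def ok_def algebra_simps)
  interpret R: hcyc "\<lambda>x y. A y x" V k l n "\<lambda>i. c (- i)" by (rule mirror)
  have "R.adj (- (i + l + 1) + l) (- (i + l + 1) + l + 2)"
    by (rule R.chord_Suc_l_adj) (use E l2 n kl6 lk in \<open>auto simp: mirror_E algebra_simps\<close>)
  then have "adj (i - 1) (i + 1)" by (simp add: mirror_adj algebra_simps)
  then show False
    using cross3_io[OF E _ b, of "i - 1" "i + 1"] cross3_oo[OF E _ b, of "i + 1" "i - 1"] l2 lk kl6 n
    by (auto simp: adj_def ok_def)
qed

section \<open>The case \<open>l = 1\<close>\<close>

text \<open>For \<open>l = 1\<close> the chord itself is the short path, and the segment that it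
  spans is the long one.\<close>

lemma fwd_less_k:
  assumes "E i (i + f)" "0 < f" "f < n" "l \<le> 1"
  shows "f < k"
proof (rule ccontr)
  assume "\<not> f < k"
  moreover have "ok k l" by (simp add: ok_def)
  ultimately show False
    using config[of "[i..i+f]" "[i, i+f]" i k l] assms lk kl6 by (auto simp: succ_simps)
qed

lemma case_l1:
  assumes l: "l \<le> 1" and n: "k + 2 \<le> n"
  shows False
proof -
  have k5: "5 \<le> k" using kl6 l by linarith
  \<comment> \<open>The spans of all arcs other than the cycle arcs, a backward arc counting with
    its complementary span.\<close>
  define X where "X = {f. 2 \<le> f \<and> f < n \<and> (\<exists>i. E i (i + f))}"
  have "finite X" by (rule finite_subset[of _ "{2..n}"]) (auto simp: X_def)
  obtain f where f: "0 < f" "f < n" "adj 0 (0 + f)" "f \<notin> {1, n - 1}"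
    using deg_out[of "{1, n - 1}" 0] card_two[of 1 "n - 1"] k5 l1 by auto
  have "f \<in> X \<or> n - f \<in> X"
  proof (cases "E 0 f")
    case True
    then have "f \<in> X" unfolding X_def using f by (auto intro: exI[of _ 0])
    then show ?thesis ..
  next
    case False
    then have "E f 0" using f by (auto simp: adj_def)
    then have "E f (f + (n - f))" using E_per(2)[of f 0] by simp
    then have "n - f \<in> X" unfolding X_def using f by (auto intro: exI[of _ f])
    then show ?thesis ..
  qed
  then have "X \<noteq> {}" by blast
  define x where "x = Min X"
  have "x \<in> X" using \<open>finite X\<close> \<open>X \<noteq> {}\<close> by (simp add: x_def)
  then obtain i where x: "2 \<le> x" "x < n" and E: "E i (i + x)" by (auto simp: X_def)
  have len: "x \<le> g \<and> g < k" if "E j (j + g)" "2 \<le> g" "g < n" for j g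
  proof -
    have "g \<in> X" using that by (auto simp: X_def)
    then show ?thesis using fwd_less_k[of j g] that l \<open>finite X\<close> by (simp add: x_def)
  qed
  have len': "x \<le> n - g \<and> n - g < k" if "E (j + g) j" "0 < g" "g \<le> n - 2" for j g
    using len[of "j + g" "n - g"] that by simp
  have xk: "x < k" using len[OF E] x by simp
  have big: "n - k + 2 \<le> x"
  proof (rule ccontr)
    assume "\<not> n - k + 2 \<le> x"
    then have "int (card ({1, n - 1} \<union> {n - k + 1..max (k - 1) (k + x - 4)})) < k + l - 1"
      using card_Un2[of "{1, n - 1}" "{n - k + 1..max (k - 1) (k + x - 4)}"] n l l1 x k5 xk
        card_two[of 1 "n - 1"]
      by (auto split: if_splits)
    then obtain g where g: "0 < g" "g < n" "adj (i + 1) (i + 1 + g)"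
        "g \<notin> {1, n - 1} \<union> {n - k + 1..max (k - 1) (k + x - 4)}"
      using deg_out[of "{1, n - 1} \<union> {n - k + 1..max (k - 1) (k + x - 4)}" "i + 1"] by auto
    from g(3) consider "E (i + 1) (i + 1 + g)" | "E (i + 1 + g) (i + 1)" by (auto simp: adj_def)
    then show False
    proof cases
      case 1
      then have "x \<le> g" "g < k" using len[of "i + 1" g] g by auto
      then show False using ban_o2[OF E, of "i + 1" "i + 1 + g"] 1 g n x l l1 k5 by (auto simp: ok_def)
    next
      case 2
      then have "n - k + 1 \<le> g" using len'[of "i + 1" g] g by auto
      then have "x < 1 + g" "k \<le> 3 + (g - x)" using g xk by auto
      then show False using ban_i2[OF E, of "i + 1" "i + 1 + g"] 2 g n x l l1 k5 by (auto simp: ok_def)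
    qed
  qed
  \<comment> \<open>All spans in \<open>X\<close> now lie between \<open>n - k + 2\<close> and
    \<open>k - 1\<close>, which leaves fewer than \<open>k\<close> offsets at every vertex.\<close>
  have "int (card ({1, n - 1} \<union> {n - k + 1..k - 1})) < k + l - 1"
    using card_Un2[of "{1, n - 1}" "{n - k + 1..k - 1}"] n l l1 k5
      card_two[of 1 "n - 1"]
    by (auto split: if_splits)
  then obtain g where g: "0 < g" "g < n" "adj 0 (0 + g)" "g \<notin> {1, n - 1} \<union> {n - k + 1..k - 1}"
    using deg_out[of "{1, n - 1} \<union> {n - k + 1..k - 1}" 0] by auto
  then show False using len[of 0 g] len'[of 0 g] big by (auto simp: adj_def)
qed

section \<open>Shortest chords\<close>

lemma degN:
  assumes "finite S" "\<And>f. 0 < f \<Longrightarrow> f < n \<Longrightarrow> adj i (i + f) \<Longrightarrow> f \<in> S"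
    and "N \<subseteq> S" "\<And>f. f \<in> N \<Longrightarrow> \<not> adj i (i + f)"
  shows "k + l - 1 + int (card N) \<le> int (card S)"
proof -
  have "k + l - 1 \<le> int (card (S - N))" by (rule degS) (use assms in auto)
  moreover have "int (card (S - N)) = int (card S) - int (card N)"
    using assms by (simp add: card_Diff_subset card_mono finite_subset of_nat_diff)
  ultimately show ?thesis by simp
qed

lemma deg_tight:
  assumes "finite S" "\<And>f. 0 < f \<Longrightarrow> f < n \<Longrightarrow> adj i (i + f) \<Longrightarrow> f \<in> S"
    "int (card S) \<le> k + l - 1" "f \<in> S"
  shows "adj i (i + f)"
  using degN[OF assms(1,2), where N="{f}"] assms(3,4) by auto

lemma deg_tight2:
  assumes "finite S" "\<And>f. 0 < f \<Longrightarrow> f < n \<Longrightarrow> adj i (i + f) \<Longrightarrow> f \<in> S"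
    "int (card S) \<le> k + l" "f \<in> S" "g \<in> S" "f \<noteq> g" "\<not> adj i (i + g)"
  shows "adj i (i + f)"
  using degN[OF assms(1,2), where N="{f, g}"] assms(3-) by auto

definition no_bwd :: "int \<Rightarrow> int \<Rightarrow> bool" where "no_bwd b s \<longleftrightarrow> (\<forall>j g. b \<le> g \<longrightarrow> g < s \<longrightarrow> \<not> E (j + g) j)"
definition no_fwd :: "int \<Rightarrow> int \<Rightarrow> bool" where "no_fwd f x \<longleftrightarrow> (\<forall>j g. f \<le> g \<longrightarrow> g < x \<longrightarrow> \<not> E j (j + g))"

lemma no_bwdD: "no_bwd b s \<Longrightarrow> E u v \<Longrightarrow> u - v < s \<Longrightarrow> u - v < b"
  unfolding no_bwd_def by (metis add_diff_cancel_left' diff_add_cancel linorder_not_le add.commute)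

lemma no_fwdD: "no_fwd f x \<Longrightarrow> E u v \<Longrightarrow> v - u < x \<Longrightarrow> v - u < f"
  unfolding no_fwd_def by (metis add_diff_cancel_left' diff_add_cancel linorder_not_le add.commute)

lemma mirror_no_bwd: "hcyc.no_bwd (\<lambda>x y. A y x) (\<lambda>i. c (- i)) b s = no_bwd b s"
proof -
  interpret R: hcyc "\<lambda>x y. A y x" V k l n "\<lambda>i. c (- i)" by (rule mirror)
  show ?thesis unfolding R.no_bwd_def no_bwd_def mirror_E
  proof safe
    fix j g assume H: "\<forall>j g. b \<le> g \<longrightarrow> g < s \<longrightarrow> \<not> E (- j) (- (j + g))" "b \<le> g" "g < s" "E (j + g) j"
    then show False using H(2-4) H(1)[rule_format, of g "- (j + g)"] by (simp add: add.commute)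
  next
    fix j g assume H: "\<forall>j g. b \<le> g \<longrightarrow> g < s \<longrightarrow> \<not> E (j + g) j" "b \<le> g" "g < s" "E (- j) (- (j + g))"
    then show False using H(2-4) H(1)[rule_format, of g "- (j + g)"] by (simp add: add.commute)
  qed
qed

lemma mirror_no_fwd: "hcyc.no_fwd (\<lambda>x y. A y x) (\<lambda>i. c (- i)) b s = no_fwd b s"
proof -
  interpret R: hcyc "\<lambda>x y. A y x" V k l n "\<lambda>i. c (- i)" by (rule mirror)
  show ?thesis unfolding R.no_fwd_def no_fwd_def mirror_E
  proof safe
    fix j g assume H: "\<forall>j g. b \<le> g \<longrightarrow> g < s \<longrightarrow> \<not> E (- (j + g)) (- j)" "b \<le> g" "g < s" "E j (j + g)"
    then show False using H(2-4) H(1)[rule_format, of g "- (j + g)"] by (simp add: add.commute)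
  next
    fix j g assume H: "\<forall>j g. b \<le> g \<longrightarrow> g < s \<longrightarrow> \<not> E j (j + g)" "b \<le> g" "g < s" "E (- (j + g)) (- j)"
    then show False using H(2-4) H(1)[rule_format, of g "- (j + g)"] by (simp add: add.commute)
  qed
qed

text \<open>Backward chords are minimised first; they exist because cycle arcs are backward arcs of
  span \<open>n - 1\<close>. Only forward chords that are not longer compete, so ties go to the
  forward ones. The thresholds are separate because for \<open>k = l\<close> a backward chord of
  span \<open>l\<close> already counts as long.\<close>

lemma extremal:
  assumes "b0 < n"
  obtains s i where "b0 \<le> s" "s < n" "E (i + s) i" "no_bwd b0 s" "no_fwd f0 (s + 1)"
    | x i where "f0 \<le> x" "x < n" "E i (i + x)" "no_bwd b0 x" "no_fwd f0 x"
proof -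
  define B where "B = {s. b0 \<le> s \<and> s < n \<and> (\<exists>i. E (i + s) i)}"
  have fB: "finite B" by (rule finite_subset[of _ "{b0..n}"]) (auto simp: B_def)
  have "E (1 + (n - 1)) 1" using E_per(1)[of 0 1] E_cyc[of 0] by simp
  then have "n - 1 \<in> B" using assms unfolding B_def by (auto intro!: exI[of _ 1])
  define s where "s = Min B"
  have "s \<in> B" using fB \<open>n - 1 \<in> B\<close> unfolding s_def by (intro Min_in) auto
  then obtain i where s: "b0 \<le> s" "s < n" "E (i + s) i" by (auto simp: B_def)
  have nb: "no_bwd b0 s" unfolding no_bwd_def
  proof (intro allI impI notI)
    fix j g assume "b0 \<le> g" "g < s" "E (j + g) j"
    then have "g \<in> B" using s by (auto simp: B_def)
    then show False using \<open>g < s\<close> fB by (simp add: s_def flip: not_le)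
  qed
  define F where "F = {x. f0 \<le> x \<and> x \<le> s \<and> (\<exists>i. E i (i + x))}"
  have fF: "finite F" by (rule finite_subset[of _ "{f0..s}"]) (auto simp: F_def)
  show ?thesis
  proof (cases "F = {}")
    case True
    then have "no_fwd f0 (s + 1)" unfolding no_fwd_def F_def by auto
    then show ?thesis using s nb that(1) by blast
  next
    case False
    define x where "x = Min F"
    have "x \<in> F" using fF False unfolding x_def by (intro Min_in) auto
    then obtain j where x: "f0 \<le> x" "x \<le> s" "E j (j + x)" by (auto simp: F_def)
    have "no_fwd f0 x" unfolding no_fwd_def
    proof (intro allI impI notI)
      fix j g assume "f0 \<le> g" "g < x" "E j (j + g)"
      then have "g \<in> F" using x by (auto simp: F_def)
      then show False using \<open>g < x\<close> fF by (simp add: x_def flip: not_le)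
    qed
    moreover have "no_bwd b0 x" using nb x unfolding no_bwd_def by auto
    ultimately show ?thesis using x s that(2)[of x j] by auto
  qed
qed

text \<open>The vertex before the head of the chord has too few possible neighbours.\<close>

lemma no_short_fwd:
  assumes E: "E i (i + x)" and x: "l + 2 \<le> x" "x < n" and nb: "no_bwd (l + 1) x" and nf: "no_fwd (l + 1) x"
    and kl: "l + 1 \<le> k" and l2: "2 \<le> l"
  shows False
proof -
  let ?b = "i + x - 1"
  have S: "f < l \<or> x \<le> k \<and> (f = l \<or> x \<le> f \<and> f < k) \<or> n - l \<le> f" if f: "0 < f" "f < n" "adj ?b (?b + f)" for f
  proof (cases "n - x + 1 \<le> f")
    case True
    have "E ?b (?b + f - n) \<or> E (?b + f - n) ?b" using f(3) by (auto simp: adj_def)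
    then show ?thesis using no_bwdD[OF nb, of ?b "?b + f - n"] no_fwdD[OF nf, of "?b + f - n" ?b] True by auto
  next
    case False
    show ?thesis
    proof (cases "f = 1")
      case True then show ?thesis using l2 by auto
    next
      case f1: False
      from f(3) consider "E ?b (?b + f)" | "E (?b + f) ?b" by (auto simp: adj_def)
      then show ?thesis
      proof cases
        case 1
        then show ?thesis using ban_o1[OF E, of ?b "?b + f"] False f f1 x l1 no_fwdD[OF nf 1]
          by (auto simp: ok_def)
      next
        case 2
        then show ?thesis using ban_i2[OF E, of ?b "?b + f"] False f f1 x l1 no_bwdD[OF nb 2]
          by (auto simp: ok_def)
      qed
    qed
  qed
  show False
  proof (cases "x \<le> k")
    case True
    have "int (card ({1..l} \<union> {x..k-1} \<union> {n-l..n-1})) < k + l - 1"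
      using card_Un3[of "{1..l}" "{x..k-1}" "{n-l..n-1}"] True x kl l1 by (auto split: if_splits)
    then obtain f where "0 < f" "f < n" "adj ?b (?b + f)" "f \<notin> {1..l} \<union> {x..k-1} \<union> {n-l..n-1}"
      using deg_out[of "{1..l} \<union> {x..k-1} \<union> {n-l..n-1}" ?b] by auto
    then show False using S[of f] l1 by auto
  next
    case False
    have "int (card ({1..l-1} \<union> {n-l..n-1})) < k + l - 1"
      using card_Un2[of "{1..l-1}" "{n-l..n-1}"] kl l1 by (auto split: if_splits)
    then obtain f where "0 < f" "f < n" "adj ?b (?b + f)" "f \<notin> {1..l-1} \<union> {n-l..n-1}"
      using deg_out[of "{1..l-1} \<union> {n-l..n-1}" ?b] by auto
    then show False using S[of f] False l1 by auto
  qed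
qed

text \<open>This is \<open>ban\<close> for the arc from \<open>i + s\<close> forward to
  \<open>i + n\<close>: it jumps over the positions outside the cap, and \<open>i + P\<close> inside
  the cap is met as \<open>i + P + n\<close>.\<close>

lemma cap_ban:
  assumes E: "E (i + s) i" and "s < n" "0 < P" "P < s" "s - P < f" "f < n - P"
  shows "E (i + P) (i + P + f) \<Longrightarrow> \<not> ok (f - (s - P)) (P + 2)"
    and "E (i + P) (i + P + f) \<Longrightarrow> \<not> ok (s - P + 1) (n - P - f + 1)"
    and "E (i + P + f) (i + P) \<Longrightarrow> \<not> ok (f - (s - P) + 1) (P + 1)"
    and "E (i + P + f) (i + P) \<Longrightarrow> \<not> ok (n - P - f) (s - P + 2)"
proof -
  have e: "i + n - (i + P + f) = n - P - f" "i + s + n - (i + P + n) = s - P" "i + P + f - (i + s) = f - (s - P)"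
    "i + P + n - (i + n) = P" by simp_all
  have "E (i + s) (i + n)" using E by simp
  note b = ban[OF this, of "i + P + f" "i + P + n", unfolded e]
  show "E (i + P) (i + P + f) \<Longrightarrow> \<not> ok (f - (s - P)) (P + 2)"
    "E (i + P) (i + P + f) \<Longrightarrow> \<not> ok (s - P + 1) (n - P - f + 1)"
    "E (i + P + f) (i + P) \<Longrightarrow> \<not> ok (f - (s - P) + 1) (P + 1)"
    "E (i + P + f) (i + P) \<Longrightarrow> \<not> ok (n - P - f) (s - P + 2)"
    using b assms by simp_all
qed

text \<open>Inside the cap, minimality leaves only neighbours within distance \<open>l\<close>.
  Outside, minimality bounds the offset from below and the crossing with the cap bounds it from
  above; for outgoing arcs both bounds are one larger.\<close>

lemma cap_neighbours:
  assumes E: "E (i + s) i" and s: "s < n" and nb: "no_bwd b0 s" and nf: "no_fwd (l + 1) (s + 1)"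
    and b0: "l \<le> b0" "b0 \<le> l + 1" "b0 \<le> s" and P: "0 < P" "l - 1 \<le> P" "P < s"
    and f: "0 < f" "f < n" "adj (i + P) (i + P + f)"
  shows "f \<le> l \<or> n - min l P \<le> f \<or> (E (i + P + f) (i + P) \<and> s \<le> f \<and> f \<le> s - P + k - 2)
    \<or> (E (i + P) (i + P + f) \<and> s + 1 \<le> f \<and> f \<le> s - P + k - 1)"
proof (cases "n - P \<le> f")
  case True
  have "E (i + P) (i + P + f - n) \<or> E (i + P + f - n) (i + P)" using f(3) by (auto simp: adj_def)
  then have "n - l \<le> f" using no_bwdD[OF nb, of "i + P" "i + P + f - n"] no_fwdD[OF nf, of "i + P + f - n" "i + P"] True P b0 by auto
  then show ?thesis using True by auto
next
  case False
  from f(3) consider "E (i + P) (i + P + f)" | "E (i + P + f) (i + P)" by (auto simp: adj_def)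
  then show ?thesis
  proof cases
    case 1
    show ?thesis
    proof (cases "f \<le> s - P")
      case True then show ?thesis using no_fwdD[OF nf 1] P by auto
    next
      case f': False
      then have "f - (s - P) < k" using cap_ban(1)[OF E s P(1,3), of f] 1 False P by (auto simp: ok_def)
      then show ?thesis using no_fwdD[OF nf 1] 1 by auto
    qed
  next
    case 2
    show ?thesis
    proof (cases "f \<le> s - P")
      case True then show ?thesis using no_bwdD[OF nb 2] P b0 by auto
    next
      case f': False
      then have "f - (s - P) + 1 < k" using cap_ban(3)[OF E s P(1,3), of f] 2 False P by (auto simp: ok_def)
      then show ?thesis using no_bwdD[OF nb 2] 2 b0 by auto
    qed
  qed
qed

section \<open>The case \<open>k > l + 1\<close>\<close>

text \<open>This and the next five lemmas are pairs of chords near \<open>j\<close> that exclude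
  each other by crossing; \<open>j\<close> will be the vertex before the tail of a shortest backward
  chord.\<close>

lemma chords1: "E (j - 1) (j + k) \<Longrightarrow> adj j (j - l) \<Longrightarrow> 2 \<le> l \<Longrightarrow> k + l < n \<Longrightarrow> False"
  using cross1[of "j - l" j "j - 1" "j + k"] cross2[of "j - 1" "j + k" j "j - l + n"] l1 lk
  by (auto simp: adj_def ok_def)

lemma chords2: "E (j + l - 1) (j - 1) \<Longrightarrow> adj j (j + l) \<Longrightarrow> 2 \<le> l \<Longrightarrow> k + l < n \<Longrightarrow> False"
  using cross1[of j "j + l" "j + l - 1" "j - 1 + n"] cross2[of "j + l - 1" "j - 1 + n" "j + l" "j + n"] l1 lk
  by (auto simp: adj_def ok_def)

lemma chords3: "E (j + l + 1) j \<Longrightarrow> E (j - 1) (j - 1 + l) \<Longrightarrow> 2 \<le> l \<Longrightarrow> k + l < n \<Longrightarrow> False"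
  using cross1[of "j + l + 1" "j + n" "j - 1 + n" "j - 1 + l + n"] l1 lk by (auto simp: ok_def)

lemma chords4: "E (j + l + 1) j \<Longrightarrow> E (j + l) (j - 1) \<Longrightarrow> 2 \<le> l \<Longrightarrow> k + l + 2 \<le> n \<Longrightarrow> False"
  using cross2[of "j + l" "j - 1 + n" "j + l + 1" "j + n"] l1 lk by (auto simp: ok_def)

lemma chords5: "E j (j + l + 2) \<Longrightarrow> E (j + l) (j - 1) \<Longrightarrow> 2 \<le> l \<Longrightarrow> k + l + 2 \<le> n \<Longrightarrow> False"
  using cross1[of j "j + l + 2" "j + l" "j - 1 + n"] l1 lk kl6 by (auto simp: ok_def)

lemma chords6: "E (j + l + 2) j \<Longrightarrow> E (j - 1) (j - 1 + l) \<Longrightarrow> 2 \<le> l \<Longrightarrow> k + l + 2 \<le> n \<Longrightarrow> False"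
  using cross1[of "j + l + 2" "j + n" "j - 1 + n" "j - 1 + l + n"] l1 lk by (auto simp: ok_def)

lemma case_main:
  assumes l2: "2 \<le> l" and kl: "l + 2 \<le> k" and n: "k + l + 2 \<le> n"
  shows False
proof -
  have "l + 1 < n" using n lk l1 by simp
  then show False
  proof (cases rule: extremal[of "l + 1" "l + 1"])
    case (2 x i)
    have "x \<noteq> l + 1" using no_chord_Suc_l[OF l2, of i] 2 n by (auto simp: add.assoc)
    then show False using no_short_fwd[OF 2(3) _ 2(2) 2(4) 2(5)] 2(1) kl l2 by auto
  next
    case (1 s i)
    note R = cap_neighbours[OF 1(3) 1(2) 1(4) 1(5)]
    let ?b = "i + (s - 1)" let ?b2 = "i + (s - 2)"
    \<comment> \<open>The offsets that \<open>cap_neighbours\<close> leaves at the last two vertices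
      before the tail of the cap.\<close>
    let ?S1 = "{1..l} \<union> {s..k} \<union> {n-l..n-1}"
    let ?S2 = "{1..l} \<union> {s..k+1} \<union> {n - min l (s - 2)..n-1}"
    have S1: "f \<in> ?S1" if "0 < f" "f < n" "adj ?b (?b + f)" for f
      using R[of "s - 1" f] that 1(1) l2 by auto
    have S2: "f \<in> ?S2" if "0 < f" "f < n" "adj ?b2 (?b2 + f)" for f
      using R[of "s - 2" f] that 1(1) l2 by auto
    have c1: "int (card ?S1) \<le> 2 * l + max 0 (k - s + 1)"
      using card_Un3[of "{1..l}" "{s..k}" "{n-l..n-1}"] l1 by (auto split: if_splits)
    have c2: "int (card ?S2) \<le> l + max 0 (k - s + 2) + min l (s - 2)"
      using card_Un3[of "{1..l}" "{s..k+1}" "{n - min l (s - 2)..n-1}"] l1 1(1) by (auto split: if_splits)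
    have fin: "finite ?S1" "finite ?S2" by auto
    have d: "k + l - 1 \<le> int (card ?S1)" by (rule degS[OF fin(1) S1])
    then have "s < l + 3" using c1 kl by linarith
    \<comment> \<open>For \<open>s = l + 2\<close> all of \<open>?S1\<close> must occur, for
      \<open>s = l + 1\<close> one offset may be vacant; \<open>?S2\<close> allows one vacancy in
      both cases.\<close>
    then have s: "s = l + 1 \<or> s = l + 2" using 1(1) by auto
    have sk: "s \<le> k" using d c1 s kl by linarith
    have m1: "adj ?b (?b + f)" if "s = l + 2" "f \<in> ?S1" for f
      by (rule deg_tight[OF fin(1) S1]) (use that c1 sk in auto)
    have m1': "adj ?b (?b + f)" if "\<not> adj ?b (?b + g)" "f \<noteq> g" "f \<in> ?S1" "g \<in> ?S1" for f g
      by (rule deg_tight2[OF fin(1) S1]) (use that c1 sk s in auto)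
    have m2: "adj ?b2 (?b2 + f)" if "\<not> adj ?b2 (?b2 + g)" "f \<noteq> g" "f \<in> ?S2" "g \<in> ?S2" for f g
      by (rule deg_tight2[OF fin(2) S2]) (use that c2 sk s in auto)
    have e: "?b2 = ?b - 1" by simp
    have k1: "E ?b2 (?b2 + (k + 1))" if "adj ?b2 (?b2 + (k + 1))"
      using R[of "s - 2" "k + 1"] that s n kl l2 by auto
    have s1: "E (?b + s) ?b" if "adj ?b (?b + s)"
      using R[of "s - 1" s] that s n kl l2 sk by auto
    have sb2: "E (?b2 + s) ?b2" if "adj ?b2 (?b2 + s)"
      using R[of "s - 2" s] that s n kl l2 sk by auto
    have X1: "\<not> (adj ?b (?b + (n - l)) \<and> adj ?b2 (?b2 + (k + 1)))"
      using chords1[of ?b] k1 l2 n adj_per(4)[of ?b "?b + (n - l)"] by (auto simp: algebra_simps)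
    have X2: "\<not> (adj ?b (?b + l) \<and> E (?b2 + l) ?b2)"
      using chords2[of ?b] l2 n by (auto simp: algebra_simps)
    show False
    proof (cases "s = l + 2")
      case True
      have "adj ?b (?b + l)" "adj ?b (?b + (n - l))" "E (?b + s) ?b"
        using m1[OF True, of l] m1[OF True, of "n - l"] m1[OF True, of s] s1 l1 sk by auto
      moreover have "adj ?b2 (?b2 + l)" using m2[of "k + 1" l] X1 calculation l1 sk True by auto
      ultimately show False using X2 chords6[of ?b] l2 n True by (auto simp: adj_def algebra_simps)
    next
      case False
      then have sl: "s = l + 1" using s by simp
      \<comment> \<open>At most one vacancy at each vertex: the case split is on the vacancy at
        \<open>?b\<close>, and every forced chord rules out another one.\<close>
      have C4': "\<not> (adj ?b (?b + (l + 1)) \<and> adj ?b2 (?b2 + (l + 1)))"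
        using chords4[of ?b] s1 sb2 sl l2 n by (auto simp: algebra_simps)
      show False
      proof (cases "adj ?b (?b + (n - l))")
        case no: False
        have "adj ?b (?b + (l + 1))" "adj ?b (?b + l)"
          using m1'[of "n - l" "l + 1"] m1'[of "n - l" l] no l1 sk sl n by auto
        moreover have "adj ?b2 (?b2 + l)" using m2[of "l + 1" l] C4' calculation l1 sk sl by auto
        ultimately show False using X2 chords3[of ?b] s1 sl l2 n by (auto simp: adj_def algebra_simps)
      next
        case True
        then have no2: "\<not> adj ?b2 (?b2 + (k + 1))" using X1 by blast
        have a: "adj ?b2 (?b2 + (l + 1))" "adj ?b2 (?b2 + l)"
          using m2[of "k + 1" "l + 1"] m2[of "k + 1" l] no2 l1 sk sl kl by auto
        then have "\<not> adj ?b (?b + (l + 1))" using C4' by blast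
        then have b: "adj ?b (?b + l)" "adj ?b (?b + (l + 2))"
          using m1'[of "l + 1" l] m1'[of "l + 1" "l + 2"] l1 sk sl kl by auto
        have "E ?b2 (?b2 + l)" using X2 a b by (auto simp: adj_def)
        then show False using b sb2 a sl chords5[of ?b] chords6[of ?b] l2 n by (auto simp: adj_def algebra_simps)
      qed
    qed
  qed
qed

end

section \<open>The case \<open>k = l + 1\<close>\<close>

text \<open>Finds consecutive positions between which the direction of the arcs at a fixed vertex
  changes, so that this vertex fits between the two.\<close>

lemma int_switch:
  fixes a b :: int
  assumes "a < b" "\<not> Q a" "Q b"
  shows "\<exists>j. a \<le> j \<and> j < b \<and> \<not> Q j \<and> Q (j + 1)"
proof -
  have "a \<le> j \<Longrightarrow> j \<le> b \<longrightarrow> \<not> Q j" if "\<forall>j. a \<le> j \<and> j < b \<longrightarrow> \<not> Q j \<longrightarrow> \<not> Q (j + 1)" for j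
    by (induction j rule: int_ge_induct) (use assms that in auto)
  from this[of b] show ?thesis using assms by force
qed

context hcyc begin

lemma E_eq: "E u v \<Longrightarrow> u = u' \<Longrightarrow> v = v' \<Longrightarrow> E u' v'" by simp
lemma adj_eq: "adj u v \<Longrightarrow> u = u' \<Longrightarrow> v = v' \<Longrightarrow> adj u' v'" by simp

lemma case_succ:
  assumes l3: "3 \<le> l" and kl: "k \<le> l + 1" "l + 1 \<le> k" and n: "2 * l + 2 \<le> n"
  shows False
proof -
  have "l + 1 < n" using n l3 by simp
  then show False
  proof (cases rule: extremal[of "l + 1" "l + 1"])
    case (2 x i)
    have "x \<noteq> l + 1" using no_chord_Suc_l[of i] 2 n l3 kl by (auto simp: add.assoc)
    then show False using no_short_fwd[OF 2(3) _ 2(2) 2(4) 2(5)] 2(1) kl l3 by auto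
  next
    case (1 s v)
    note R = cap_neighbours[OF 1(3) 1(2) 1(4) 1(5)] and Sb = cap_ban[OF 1(3) 1(2), unfolded ok_def]
    \<comment> \<open>Both vertices are saturated. The chords of \<open>?b\<close> over
      \<open>l\<close> and of \<open>?p\<close> over \<open>s\<close> positions meet in
      \<open>v + s + l - 1\<close>: the first enters this vertex, the second leaves it.\<close>
    let ?b = "v + (s - 1)" let ?p = "v + (l - 1)"
    let ?S = "{1..l} \<union> {n-l..n-1}"
    have tb: "adj ?b (?b + f)" if "f \<in> ?S" for f
    proof (rule deg_tight[of ?S, OF _ _ _ that])
      show "f \<in> ?S" if "0 < f" "f < n" "adj ?b (?b + f)" for f
        using R[of "s - 1" f] that 1(1) kl l3 by auto
      show "int (card ?S) \<le> k + l - 1"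
        using card_Un2[of "{1..l}" "{n-l..n-1}"] kl l3 by (auto split: if_splits)
    qed simp
    have "adj ?b (?b + l)" using tb[of l] l3 by auto
    \<comment> \<open>In whichever direction this chord of span \<open>l\<close> points, it is also
      a chord of span \<open>n - l\<close> the other way, which minimality of \<open>s\<close>
      bounds.\<close>
    have ns: "s \<le> n - l"
    proof (cases "E ?b (?b + l)")
      case True
      then show ?thesis using no_bwdD[OF 1(4), of "?b + n" "?b + l"] n by (cases "n - l < s") auto
    next
      case False
      then have "E (?b + l) (?b + n)" using \<open>adj ?b (?b + l)\<close> by (simp add: adj_def)
      then show ?thesis using no_fwdD[OF 1(5), of "?b + l" "?b + n"] n by (cases "n - l < s + 1") auto
    qed
    have Eb: "E ?b (?b + l)"
      using \<open>adj ?b (?b + l)\<close> Sb(3)[of "s - 1" l] 1(1) kl ns l3 by (auto simp: adj_def ok_def)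
    let ?Sp = "{1..l} \<union> {s} \<union> {n-l+1..n-1}"
    have Sp: "f \<in> ?Sp" if "0 < f" "f < n" "adj ?p (?p + f)" for f
      using R[of "l - 1" f] that 1(1) kl l3 ns Sb(1)[of "l - 1" f] by (auto simp: ok_def)
    have "adj ?p (?p + s)"
    proof (rule deg_tight[of ?Sp, OF _ Sp])
      show "int (card ?Sp) \<le> k + l - 1"
        using card_Un3[of "{1..l}" "{s}" "{n-l+1..n-1}"] kl l3 by (auto split: if_splits)
    qed auto
    then have Ep: "E (?p + s) ?p" using no_fwdD[OF 1(5), of ?p "?p + s"] 1(1) by (auto simp: adj_def)
    have e: "?b + l = v + s + l - 1" "?p + s = v + s + l - 1" by auto
    show False
    proof (cases "E ?b (v + s + 1)")
      case True
      have "ok l (l + 1)" by (auto simp: ok_def kl)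
      show False
        by (rule config[of "[?b] @ [v+s+1..v+s+l-1] @ [?p]" "[?b, v+s] @ [v..?p]" v, OF _ _ _ _ _ _ _ _ _ _ _ \<open>ok l (l + 1)\<close>])
          (use True Ep 1(1,3) ns l3 E_cyc[of ?b] in \<open>auto simp: succ_simps algebra_simps\<close>)
    next
      case False
      have "E ?b (v + s + (l - 1))" by (rule E_eq[OF Eb]) simp_all
      \<comment> \<open>Inserting \<open>?b\<close> between \<open>v + s + j\<close> and
        \<open>v + s + j + 1\<close> makes the path through this segment one arc longer.\<close>
      then obtain j where j: "1 \<le> j" "j < l - 1" "\<not> E ?b (v + s + j)" "E ?b (v + s + (j + 1))"
        using int_switch[of 1 "l - 1" "\<lambda>j. E ?b (v + s + j)"] False l3 by auto
      have "E (v + s + j) ?b" using tb[of "j + 1"] j by (auto simp: adj_def algebra_simps)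
      have "ok (l + 1) l" by (auto simp: ok_def kl)
      show False
        by (rule config[of "[v+s..v+s+j] @ [?b] @ [v+s+j+1..v+s+l-1] @ [?p]" "[v+s] @ [v..?p]" v, OF _ _ _ _ _ _ _ _ _ _ _ \<open>ok (l + 1) l\<close>])
          (use j \<open>E (v + s + j) ?b\<close> Ep 1(1,3) ns l3 in \<open>auto simp: succ_simps algebra_simps\<close>)
    qed
  qed
qed

section \<open>The case \<open>k = l\<close>\<close>

lemma no_bwd_cases: "no_bwd b s \<Longrightarrow> E u v \<Longrightarrow> u - v < b \<or> s \<le> u - v"
  using no_bwdD[of b s u v] by linarith

lemma no_fwd_cases: "no_fwd b s \<Longrightarrow> E u v \<Longrightarrow> v - u < b \<or> s \<le> v - u"
  using no_fwdD[of b s u v] by linarith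

text \<open>The exclusions leave \<open>2 * l - 1\<close> offsets at the vertex before the head,
  just the required degree. An incoming arc at offset \<open>l - 1\<close> would make an excluded
  crossing.\<close>

lemma eq_fwd_head:
  assumes kl: "k \<le> l" and E: "E i (i + x)" and x: "l + 2 \<le> x" "x < n" and nb: "no_bwd l x" and nf: "no_fwd (l + 1) x"
    and f: "f \<in> {1..l-1} \<union> {n-l..n-1}"
  shows "adj (i + x - 1) (i + x - 1 + f)"
    and "f \<le> n - x \<Longrightarrow> f = l - 1 \<Longrightarrow> E (i + x - 1) (i + x - 1 + f)"
proof -
  let ?b = "i + x - 1" let ?S = "{1..l-1} \<union> {n-l..n-1}"
  have l3: "3 \<le> l" using kl6 kl lk by simp
  have R: "f \<in> ?S \<and> (f = l - 1 \<longrightarrow> f \<le> n - x \<longrightarrow> E ?b (?b + f))" if f: "0 < f" "f < n" "adj ?b (?b + f)" for f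
  proof (cases "n - x + 1 \<le> f")
    case True
    have "E ?b (?b + f - n) \<or> E (?b + f - n) ?b" using f(3) by (auto simp: adj_def)
    then show ?thesis using no_bwdD[OF nb, of ?b "?b + f - n"] no_fwdD[OF nf, of "?b + f - n" ?b] True f by auto
  next
    case False
    show ?thesis
    proof (cases "f = 1")
      case True then show ?thesis using l3 by auto
    next
      case f1: False
      from f(3) consider "E ?b (?b + f)" | "E (?b + f) ?b" by (auto simp: adj_def)
      then show ?thesis
      proof cases
        case 1
        then show ?thesis using ban_o1[OF E, of ?b "?b + f", unfolded ok_def] False f f1 x l3 kl lk by (auto simp: ok_def)
      next
        case 2
        then show ?thesis using ban_i2[OF E, of ?b "?b + f", unfolded ok_def] False f f1 x l3 kl lk by (auto simp: ok_def)
      qed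
    qed
  qed
  show *: "adj ?b (?b + f)"
  proof (rule deg_tight[of ?S, OF _ _ _ f])
    show "int (card ?S) \<le> k + l - 1"
      using card_Un2[of "{1..l-1}" "{n-l..n-1}"] kl lk l3 by (auto split: if_splits)
  qed (use R in auto)
  show "f \<le> n - x \<Longrightarrow> f = l - 1 \<Longrightarrow> E ?b (?b + f)" using R[of f] * l3 x by auto
qed

lemma eq_fwd_tail:
  assumes kl: "k \<le> l" and E: "E i (i + x)" and x: "l + 2 \<le> x" "x < n" and nb: "no_bwd l x" and nf: "no_fwd (l + 1) x"
    and f: "f \<in> {1..l-1} \<union> {n-l..n-1}"
  shows "adj (i + 1 - f) (i + 1)"
proof -
  interpret R: hcyc "\<lambda>x y. A y x" V k l n "\<lambda>i. c (- i)" by (rule mirror)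
  show ?thesis
    using R.eq_fwd_head(1)[of "- (i + x)" x f, unfolded mirror_E mirror_adj mirror_no_bwd mirror_no_fwd, OF kl _ x nb nf f] E
    by (simp add: algebra_simps)
qed

text \<open>Saturation at both ends joins \<open>i - 1\<close> to \<open>i + 1\<close> and gives an
  arc from \<open>i + x - 1\<close> over \<open>l - 1\<close> positions. With the given chord the
  lengths are \<open>l\<close> and \<open>x\<close>, or \<open>l + 1\<close> and
  \<open>x - 1\<close>.\<close>

lemma eq_no_fwd:
  assumes kl: "k \<le> l" and E: "E i (i + x)" and x: "l + 2 \<le> x" "x < n" and nb: "no_bwd l x" and nf: "no_fwd (l + 1) x"
    and n: "2 * l + 1 \<le> n"
  shows False
proof -
  have l3: "3 \<le> l" using kl6 kl lk by simp
  let ?b = "i + x - 1"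
  have "adj ?b (?b + (n - l))" using eq_fwd_head(1)[OF kl E x nb nf, of "n - l"] l3 n by auto
  moreover have "?b + (n - l) = ?b - l + n" by simp
  ultimately have "adj ?b (?b - l)" by (simp only: adj_per)
  then have "E (?b - l) ?b" using no_bwdD[OF nb, of ?b "?b - l"] x by (auto simp: adj_def)
  then have nx: "x \<le> n - l" using no_bwd_cases[OF nb, of "?b - l + n" ?b] n by auto
  have "E ?b (?b + (l - 1))" using eq_fwd_head[OF kl E x nb nf, of "l - 1"] l3 nx by auto
  moreover have "adj (i - 1) (i + 1)" using eq_fwd_tail[OF kl E x nb nf, of 2] l3 by auto
  moreover have "ok l x" "ok (l + 1) (x - 1)" unfolding ok_def using x kl lk by auto
  ultimately show False
    using cross3_io[OF E, of "i - 1" "i + 1" ?b "?b + (l - 1)"] cross3_oo[OF E, of "i + 1" "i - 1" ?b "?b + (l - 1)"] x nx l3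
    by (auto simp: adj_def algebra_simps)
qed

text \<open>Only \<open>2 * l - 1\<close> positions are possible for neighbours, so all of them occur.\<close>

lemma eq_cap_left:
  assumes kl: "k \<le> l" and E: "E (i + s) i" and s: "l \<le> s" "s < n" and nb: "no_bwd l s" and nf: "no_fwd (l + 1) (s + 1)"
    and n: "2 * l + 1 \<le> n"
  shows "f \<in> {1..l} \<union> {n-l+1..n-1} \<Longrightarrow> adj (i + l - 1) (i + l - 1 + f)" and "E (i + l - 1) (i + l - 1 + l)"
proof -
  have l3: "3 \<le> l" using kl6 kl lk by simp
  have e: "i + (l - 1) = i + l - 1" by simp
  note R = cap_neighbours[OF E s(2) nb nf _ _ s(1), of "l - 1", unfolded e] and Sb = cap_ban[OF E s(2), of "l - 1", unfolded e ok_def]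
  let ?S = "{1..l} \<union> {n-l+1..n-1}"
  have S: "f \<in> ?S \<and> (f = l \<longrightarrow> E (i + l - 1) (i + l - 1 + f))" if "0 < f" "f < n" "adj (i + l - 1) (i + l - 1 + f)" for f
  proof -
    have "f \<in> ?S" using R[of f] that kl lk l3 s by auto
    moreover have "\<not> E (i + l - 1 + l) (i + l - 1)"
    proof
      assume *: "E (i + l - 1 + l) (i + l - 1)"
      then have "s = l" using no_bwd_cases[OF nb *] s by auto
      then show False using Sb(3)[of l] * n l3 s kl lk by (auto simp: ok_def)
    qed
    ultimately show ?thesis using that by (auto simp: adj_def)
  qed
  have *: "adj (i + l - 1) (i + l - 1 + f)" if "f \<in> ?S" for f
  proof (rule deg_tight[of ?S, OF _ _ _ that])
    show "int (card ?S) \<le> k + l - 1"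
      using card_Un2[of "{1..l}" "{n-l+1..n-1}"] kl lk l3 by (auto split: if_splits)
  qed (use S in auto)
  show "f \<in> ?S \<Longrightarrow> adj (i + l - 1) (i + l - 1 + f)" by (rule *)
  show "E (i + l - 1) (i + l - 1 + l)" using *[of l] S[of l] l3 n by auto
qed

lemma eq_cap_right:
  assumes kl: "k \<le> l" and E: "E (i + s) i" and s: "l \<le> s" "s < n" and nb: "no_bwd l s" and nf: "no_fwd (l + 1) (s + 1)"
    and n: "2 * l + 1 \<le> n"
  shows "f \<in> {1..l} \<union> {n-l+1..n-1} \<Longrightarrow> adj (i + s - l + 1 - f) (i + s - l + 1)"
proof -
  interpret R: hcyc "\<lambda>x y. A y x" V k l n "\<lambda>i. c (- i)" by (rule mirror)
  note r = R.eq_cap_left[of "- (i + s)" s, unfolded mirror_E mirror_adj mirror_no_bwd mirror_no_fwd, OF kl _ s nb nf n]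
  show "f \<in> {1..l} \<union> {n-l+1..n-1} \<Longrightarrow> adj (i + s - l + 1 - f) (i + s - l + 1)" using r(1) E
    by (simp add: algebra_simps)
qed

text \<open>The segments spanned by the two chords share one arc, and both paths of the crossing
  have length exactly \<open>l\<close>.\<close>

lemma eq_ban: "k \<le> l \<Longrightarrow> E i (i + l) \<Longrightarrow> E (i + l - 1) (i + l - 1 + l) \<Longrightarrow> 2 * l + 1 \<le> n \<Longrightarrow> False"
  using cross1[of i "i + l" "i + l - 1" "i + l - 1 + l", unfolded ok_def] kl6 lk by auto

text \<open>Knowing one direction saves one arc on the segment in comparison with
  \<open>cross3\<close>.\<close>

lemma cross3_v:
  assumes xy: "E x y" and vf: "E v f" and gu: "adj g u" and o: "v \<le> x" "x < f" "f \<le> g" "g < y" "y \<le> u" "u < v + n"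
    and ok: "ok (x - v + 1 + u - y) (g - f + 1)"
  shows False
proof -
  have "ok (x - v + 1 + u - y) (g - f + 2)" "ok (x - v + 2 + u - y) (g - f + 1)"
    using ok unfolding ok_def by auto
  then show False
    using gu cross3_io[OF xy vf _ o] cross3_ii[OF xy vf _ o] by (auto simp: adj_def)
qed

lemma cross3_u:
  assumes xy: "E x y" and vf: "adj v f" and gu: "E g u" and o: "v \<le> x" "x < f" "f \<le> g" "g < y" "y \<le> u" "u < v + n"
    and ok: "ok (x - v + 1 + u - y) (g - f + 1)"
  shows False
proof -
  have "ok (x - v + 1 + u - y) (g - f + 2)" "ok (x - v + 2 + u - y) (g - f + 1)"
    using ok unfolding ok_def by auto
  then show False
    using vf cross3_io[OF xy _ gu o] cross3_oo[OF xy _ gu o] by (auto simp: adj_def)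
qed

lemma eq_near:
  assumes kl: "k \<le> l" and l5: "5 \<le> l" and n: "2 * l + 2 \<le> n" and E: "E i (i + (l + 2))"
    and f: "f \<in> {1..l+1} \<union> {n-l+1..n-1}" "g \<in> {1..l+1} \<union> {n-l+1..n-1}" "f \<noteq> g" "\<not> adj (i + 1) (i + 1 + g)"
  shows "adj (i + 1) (i + 1 + f)"
proof (rule deg_tight2[OF _ _ _ f])
  show "int (card ({1..l+1} \<union> {n-l+1..n-1})) \<le> k + l"
    using card_Un2[of "{1..l+1}" "{n-l+1..n-1}"] lk l5 by (auto split: if_splits)
  fix f assume f: "0 < f" "f < n" "adj (i + 1) (i + 1 + f)"
  show "f \<in> {1..l+1} \<union> {n-l+1..n-1}"
  proof (rule ccontr)
    assume "f \<notin> {1..l+1} \<union> {n-l+1..n-1}"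
    then show False using f ban_i1[OF E, of "i + 1" "i + 1 + f", unfolded ok_def]
        ban_o2[OF E, of "i + 1" "i + 1 + f", unfolded ok_def] kl lk l5 by (auto simp: adj_def)
  qed
qed simp

text \<open>For each \<open>g\<close> the chords \<open>P g\<close> and \<open>Q g\<close> exclude
  each other, as both paths would have length at least \<open>l\<close>. But each of them fails for
  at most one \<open>g\<close>, and there are three values 2, 3, 4 to choose from.\<close>

lemma eq_no_l2:
  assumes kl: "k \<le> l" and l5: "5 \<le> l" and n: "2 * l + 2 \<le> n"
  shows "\<not> E i (i + (l + 2))"
proof
  assume E: "E i (i + (l + 2))"
  interpret R: hcyc "\<lambda>x y. A y x" V k l n "\<lambda>i. c (- i)" by (rule mirror)
  let ?S = "{1..l+1} \<union> {n-l+1..n-1}"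
  let ?b = "i + l + 1"
  have a: "adj (i + 1) (i + 1 + f)" if "f \<in> ?S" "g \<in> ?S" "f \<noteq> g" "\<not> adj (i + 1) (i + 1 + g)" for f g
    by (rule eq_near[OF kl l5 n E that])
  have b: "adj (?b - f) ?b" if "f \<in> ?S" "g \<in> ?S" "f \<noteq> g" "\<not> adj (?b - g) ?b" for f g
    using R.eq_near[of "- (i + (l + 2))" f g, unfolded mirror_E mirror_adj, OF kl l5 n _ that(1-3)] that(4) E
    by (simp add: algebra_simps)
  have a': "adj (i + 1 - f) (i + 1)" if "2 \<le> f" "f < l" "2 \<le> g" "g < l" "f \<noteq> g" "\<not> adj (i + 1 - g) (i + 1)" for f g
  proof -
    have e: "i + 1 + (n - h) = i + 1 - h + n" for h by simp
    have "adj (i + 1) (i + 1 + (n - f))"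
      by (rule a[of _ "n - g"]) (use that n in \<open>auto simp only: e adj_per\<close>, auto simp: adj_commute)
    then show ?thesis by (auto simp only: e adj_per adj_commute)
  qed
  have b': "adj ?b (?b + f)" if "2 \<le> f" "f < l" "2 \<le> g" "g < l" "f \<noteq> g" "\<not> adj ?b (?b + g)" for f g
  proof -
    have e: "?b - (n - h) = ?b + h - n" for h by simp
    have "adj (?b - (n - f)) ?b"
      by (rule b[of _ "n - g"]) (use that n in \<open>auto simp only: e adj_per\<close>, auto simp: adj_commute)
    then show ?thesis by (auto simp only: e adj_per adj_commute)
  qed
  have X: "\<not> (adj (i + 1 - g) (i + 1) \<and> adj ?b (?b + (l + 1 - g)))" if "2 \<le> g" "g < l" for g
    using cross3[OF E, of "i + 1 - g" "i + 1" ?b "?b + (l + 1 - g)", unfolded ok_def] that n kl lk l5 by auto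
  define P where "P g = adj (i + 1 - g) (i + 1)" for g
  define Q where "Q g = adj ?b (?b + (l + 1 - g))" for g
  have "P f \<or> P g" "Q f \<or> Q g" if "2 \<le> f" "f < g" "g < 5" for f g
    using a'[of f g] b'[of "l + 1 - f" "l + 1 - g"] that l5 unfolding P_def Q_def by auto
  from this[of 2 3] this[of 2 4] this[of 3 4]
  show False using X[of 2] X[of 3] X[of 4] l5 unfolding P_def[symmetric] Q_def[symmetric] by auto
qed

end

section \<open>Case \<open>k = l\<close>: a shortest chord that points backwards\<close>

locale eqcap = hcyc A V k l n c for A :: "'v \<Rightarrow> 'v \<Rightarrow> bool" and V k l n c +
  fixes v s :: int
  assumes kl: "k \<le> l" and cap: "E (v + s) v" and ls: "l \<le> s" and sn: "s < n"
    and nb: "no_bwd l s" and nf: "no_fwd (l + 1) (s + 1)" and n: "2 * l + 1 \<le> n"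
begin

lemma mirror_eqcap: "eqcap (\<lambda>x y. A y x) V k l n (\<lambda>i. c (- i)) (- (v + s)) s"
proof -
  interpret R: hcyc "\<lambda>x y. A y x" V k l n "\<lambda>i. c (- i)" by (rule mirror)
  show ?thesis
    by unfold_locales (use kl cap ls sn nb nf n in \<open>auto simp: mirror_E mirror_no_bwd mirror_no_fwd add.commute\<close>)
qed

lemma l3: "3 \<le> l" using kl6 kl lk by simp

lemma no_l1: "\<not> E i (i + (l + 1))"
  using no_chord_Suc_l[of i] l3 n kl by (auto simp: add.assoc)

lemmas adj_left = eq_cap_left(1)[OF kl cap ls sn nb nf n] and E_left = eq_cap_left(2)[OF kl cap ls sn nb nf n]
  and adj_right = eq_cap_right[OF kl cap ls sn nb nf n]

text \<open>If \<open>n - s = l\<close>, each vertex has \<open>2 * l\<close> possible neighbours. A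
  chord of span \<open>l\<close> from \<open>u\<close> makes offset \<open>l\<close> at
  \<open>u + l - 1\<close> vacant, so the others occur, among them the chord of span
  \<open>l\<close> from \<open>u - 1\<close>. Descending from \<open>E_left\<close> one arrives at a
  pair excluded by \<open>eq_ban\<close>.\<close>

lemma not_local: "n - s \<noteq> l"
proof
  assume ns: "n - s = l"
  have bwd: "\<not> E (u + l) u" for u
    using no_fwd_cases[OF nf, of "u + l" "u + n"] ns n by auto
  have step: "E (u - 1) (u - 1 + l)" if u: "E u (u + l)" for u
  proof -
    let ?w = "u + l - 1" let ?S = "{1..l} \<union> {n-l..n-1}"
    have e: "?w + (n - l) = u - 1 + n" by simp
    have "adj ?w (?w + (n - l))"
    proof (rule deg_tight2[of ?S _ _ l])
      show "int (card ?S) \<le> k + l" using card_Un2[of "{1..l}" "{n-l..n-1}"] lk l3 by (auto split: if_splits)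
      show "\<not> adj ?w (?w + l)" using eq_ban[OF kl u _ n] bwd[of ?w] by (auto simp: adj_def)
      fix f assume f: "0 < f" "f < n" "adj ?w (?w + f)"
      then show "f \<in> ?S" using no_fwd_cases[OF nf, of ?w "?w + f"] no_fwd_cases[OF nf, of "?w + f" "?w + n"] ns
        by (auto simp: adj_def)
    qed (use l3 n in auto)
    then have "adj ?w (u - 1)" unfolding e by simp
    then show ?thesis using bwd[of "u - 1"] by (auto simp: adj_def algebra_simps)
  qed
  have "E (v + l - 1 - int j) (v + l - 1 - int j + l)" for j
  proof (induction j)
    case 0 then show ?case using E_left by simp
  next
    case (Suc j) then show ?case using step[of "v + l - 1 - int j"] by (simp add: algebra_simps)
  qed
  from this[of "nat (l - 1)"] show False using eq_ban[OF kl _ _ n, of v] E_left l3 by simp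
qed

text \<open>Read the other way round, the chord \<open>E_left\<close> and the cap have spans
  \<open>n - l\<close> and \<open>n - s\<close>, which minimality, \<open>not_local\<close> and
  \<open>no_l1\<close> restrict.\<close>

lemma wide: "s + 1 \<le> n - s" "l + 2 \<le> n - s"
proof -
  have "s \<le> n - l" using no_bwd_cases[OF nb, of "v + l - 1 + n" "v + l - 1 + l"] E_left n by auto
  moreover have E: "E (v + s) (v + s + (n - s))" using cap E_per(2)[of "v + s" v] by simp
  ultimately show s: "s + 1 \<le> n - s" using no_fwd_cases[OF nf E] not_local by auto
  have "n - s \<noteq> l + 1" using E no_l1 by metis
  then show "l + 2 \<le> n - s" using s ls by simp
qed

lemma cap_n: "E (v + s) (v + n)" using cap by simp

lemma far_inner:
  assumes "2 * l - 1 \<le> s"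
  shows "adj (v + s - (l - 2)) (v + s + 1) \<or> E (v + s - (l - 2)) (v + s + 2)"
proof -
  have e: "v + (s - (l - 2)) = v + s - (l - 2)" by simp
  let ?b = "v + s - (l - 2)" let ?S = "{1..l} \<union> {n-l..n-1}"
  note R = cap_neighbours[OF cap sn nb nf _ _ ls, of "s - (l - 2)", unfolded e]
  have "adj ?b (?b + (l - 1))" if "\<not> adj ?b (?b + l)"
  proof (rule deg_tight2[OF _ _ _ _ _ _ that, of ?S])
    show "int (card ?S) \<le> k + l" using card_Un2[of "{1..l}" "{n-l..n-1}"] lk l3 by (auto split: if_splits)
    fix f assume f: "0 < f" "f < n" "adj ?b (?b + f)"
    then show "f \<in> ?S" using R[of f] assms kl l3 by auto
  qed (use l3 in auto)
  moreover have "?b + (l - 1) = v + s + 1" "?b + l = v + s + 2" by simp_all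
  moreover have "\<not> E (?b + l) ?b" using no_bwd_cases[OF nb, of "?b + l" ?b] assms l3 by auto
  ultimately show ?thesis by (auto simp only: adj_def)
qed

text \<open>In a long cap the chords over its two ends do not interfere: the part outside the cap
  gives one path, and the two end pieces inside, joined by the cap, give the other.\<close>

lemma case_far: "2 * l - 1 \<le> s \<Longrightarrow> False"
proof -
  assume s: "2 * l - 1 \<le> s"
  interpret R: eqcap "\<lambda>x y. A y x" V k l n "\<lambda>i. c (- i)" "- (v + s)" s by (rule mirror_eqcap)
  let ?b = "v + s - (l - 2)" let ?a = "v + l - 2"
  have "adj (v - 1) ?a \<or> E (v - 2) ?a" using R.far_inner[OF s, unfolded mirror_E mirror_adj] by (simp add: algebra_simps)
  then have a: "adj (v - 1 + n) (?a + n) \<or> E (v - 2 + n) (?a + n)" by simp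
  show False
    using far_inner[OF s] a s l3 wide
      cross3[OF cap_n, of ?b "v + s + 1" "v - 1 + n" "?a + n", unfolded ok_def]
      cross3_v[OF cap_n, of ?b "v + s + 2" "v - 1 + n" "?a + n", unfolded ok_def]
      cross3_u[OF cap_n, of ?b "v + s + 1" "v - 2 + n" "?a + n", unfolded ok_def]
      cross3_io[OF cap_n, of ?b "v + s + 2" "v - 2 + n" "?a + n", unfolded ok_def] kl lk
    by auto
qed

lemma case_2l2: "s = 2 * l - 2 \<Longrightarrow> False"
  using cap_ban(2)[OF cap sn, of "l - 1" l, unfolded ok_def] E_left wide l3 kl lk by (auto simp: algebra_simps)

lemma adj_cap_ends: "s \<le> 2 * l - 3 \<Longrightarrow> adj (v + l - 1) (v + s + 1)" "s \<le> 2 * l - 3 \<Longrightarrow> adj (v - 1) (v + s - l + 1)"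
  using adj_eq[OF adj_left[of "s - l + 2"]] adj_eq[OF adj_right[of "s - l + 2"]] ls by auto

text \<open>The two end pieces joined by the cap make a path of length at least
  \<open>2 * s - 2 * l + 3\<close>; the first assumption says that this suffices.\<close>

lemma case_mid:
  assumes "3 * l - 3 \<le> 2 * s" "s \<le> 2 * l - 3"
  shows False
  using cross3[OF cap_n, of "v + l - 1" "v + s + 1" "v - 1 + n" "v + s - l + 1 + n", unfolded ok_def]
    adj_cap_ends assms wide l3 kl lk ls by auto

end

context hcyc begin

text \<open>Let the neighbour of \<open>y + e\<close> lie \<open>t = n - f - e\<close> positions
  before the tail. A chord from \<open>y + x - 1\<close> over \<open>l - t\<close> positions would
  complete a three chord configuration, so the known chords over up to \<open>J\<close> positions
  limit \<open>t\<close>.\<close>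

lemma eq_near_tail:
  assumes kl: "k \<le> l" and E: "E y (y + x)" and e: "1 \<le> e" "l + 1 + e \<le> x" "x + l \<le> n"
    and J: "J < l" "\<And>j. 1 \<le> j \<Longrightarrow> j \<le> J \<Longrightarrow> adj (y + x - 1) (y + x - 1 + j)"
    and a: "adj (y + e) (y + e + f)" "x - e < f" "f < n - e"
  shows "n - f - e + J < l"
proof (rule ccontr)
  assume H: "\<not> n - f - e + J < l"
  have "n - f - e \<le> l - 2"
    using a e kl lk l1 ban_o2[OF E, of "y + e" "y + e + f", unfolded ok_def] ban_i1[OF E, of "y + e" "y + e + f", unfolded ok_def]
    by (auto simp: adj_def)
  then have "adj (y + x - 1) (y + x - 1 + (l - (n - f - e)))" using J H by auto
  moreover have "adj (y + e + f - n) (y + e)" using a by (simp add: adj_commute)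
  ultimately show False
    using cross3[OF E, of "y + e + f - n" "y + e" "y + x - 1" "y + x - 1 + (l - (n - f - e))", unfolded ok_def]
      a e kl lk l1 \<open>n - f - e \<le> l - 2\<close> by auto
qed

end

context eqcap begin

text \<open>With the cap and the chord at \<open>v - 1\<close>, a chord between \<open>v + P\<close>
  and \<open>v - T\<close> makes the segment from \<open>v - T\<close> to \<open>v - 1\<close> part
  of a path, which bounds \<open>T\<close>.\<close>

lemma far_T:
  assumes a: "adj (v - 1) (v + P')" "0 \<le> P'" "P' < P" "P \<le> s" "l \<le> s - P + 1 + P'" and T: "1 \<le> T" "T < n - s"
  shows "E (v + P) (v - T) \<Longrightarrow> T \<le> l - 1" and "E (v - T) (v + P) \<Longrightarrow> T \<le> l"
proof -
  have a': "adj (v - 1 + n) (v + P' + n)" using a by simp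
  show "T \<le> l - 1" if "E (v + P) (v - T)"
    using cross3_v[OF cap_n _ a', of "v + P" "v - T + n", unfolded ok_def] that a T kl lk by force
  show "T \<le> l" if "E (v - T) (v + P)"
  proof (rule ccontr)
    assume "\<not> T \<le> l"
    moreover have "adj (v + P) (v - T + n)" using that by (simp add: adj_def)
    ultimately show False
      using cross3[OF cap_n _ a', of "v + P" "v - T + n", unfolded ok_def] a T kl lk l1 by force
  qed
qed

text \<open>\<open>v + d\<close> is the vertex saturated by \<open>adj_right\<close>. In a short cap
  its two successors are examined.\<close>

definition d :: int where "d = s - l + 1"

section \<open>Case \<open>k = l\<close>: a short cap\<close>

context
  assumes small: "2 * s \<le> 3 * l - 4"
begin

lemma d: "1 \<le> d" "2 * d \<le> l - 2" "s = l + d - 1" "4 \<le> l"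
  using small ls l3 by (auto simp: d_def)

lemma adj_right': "1 \<le> j \<Longrightarrow> j < l \<Longrightarrow> adj (v + d) (v + d + j)"
proof -
  assume j: "1 \<le> j" "j < l"
  have "adj (v + s - l + 1 - (n - j)) (v + s - l + 1)" using adj_right[of "n - j"] j by auto
  moreover have "v + s - l + 1 - (n - j) = v + d + j - n" "v + s - l + 1 = v + d" by (auto simp: d_def)
  ultimately show ?thesis by (simp only: adj_per adj_commute)
qed

lemma adj_right1: "adj (v - 1) (v + d)"
  by (rule adj_eq[OF adj_right[of "d + 1"]]) (use d in auto)

text \<open>Otherwise the arc is a long forward chord, and by \<open>eq_near_tail\<close> the vertex
  after its tail has no neighbour beyond the chord except its predecessor: at most \<open>x\<close>
  neighbours, too few.\<close>

lemma m_in: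
  assumes T: "1 \<le> T" "T < n - s" and E: "E (v - T) (v + (d + 1))"
  shows "T + d + 1 \<le> l"
proof (rule ccontr)
  assume "\<not> T + d + 1 \<le> l"
  define x where "x = T + d + 1"
  have Tl: "T \<le> l" using far_T(2)[OF adj_right1, of "d + 1" T] T E d by auto
  have E': "E (v - T) (v - T + x)" by (rule E_eq[OF E]) (auto simp: x_def)
  have "x \<noteq> l + 1" using no_l1 E' by blast
  then have x: "l + 2 \<le> x" using \<open>\<not> T + d + 1 \<le> l\<close> by (simp add: x_def)
  have xs: "x \<le> s + 2" using Tl d by (simp add: x_def)
  let ?S = "{1..x-1} \<union> {n-1}"
  have "k + l - 1 \<le> int (card ?S)"
  proof (rule degS[of _ "v - T + 1"])
    fix f assume f: "0 < f" "f < n" "adj (v - T + 1) (v - T + 1 + f)"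
    show "f \<in> ?S"
    proof (rule ccontr)
      assume "f \<notin> ?S"
      moreover have "adj (v - T + x - 1) (v - T + x - 1 + j)" if "1 \<le> j" "j \<le> l - 1" for j
        by (rule adj_eq[OF adj_right'[of j]]) (use that in \<open>auto simp: x_def\<close>)
      ultimately show False using eq_near_tail[OF kl E', of 1 "l - 1" f] f x xs wide by auto
    qed
  qed simp
  then show False using card_Un2[of "{1..x-1}" "{n-1}"] x xs d lk by (auto split: if_splits)
qed

lemma m_out:
  assumes T: "1 \<le> T" "T < n - s" and E: "E (v + (d + 1)) (v - T)"
  shows "T + d + 1 < l \<or> T = l - 1 \<or> T = l - 2"
  using far_T(1)[OF adj_right1, of "d + 1" T] T E d no_bwd_cases[OF nb E] by auto

text \<open>The arc has span \<open>s\<close>, so it is itself a shortest backward chord. Its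
  \<open>E_left\<close> and the chord forced from \<open>v + l\<close> form a pair excluded by
  \<open>eq_ban\<close>.\<close>

lemma m_l2: "l + 1 \<le> s \<Longrightarrow> \<not> E (v + (d + 1)) (v - (l - 2))"
proof
  assume s: "l + 1 \<le> s" and E: "E (v + (d + 1)) (v - (l - 2))"
  interpret B: eqcap A V k l n c "v - (l - 2)" s
  proof unfold_locales
    show "E (v - (l - 2) + s) (v - (l - 2))" by (rule E_eq[OF E]) (auto simp: d_def)
  qed (use kl ls sn nb nf n in auto)
  have E1: "E (v + 1) (v + 1 + l)" by (rule E_eq[OF B.E_left]) auto
  let ?S = "{1..l} \<union> {n-l..n-1}"
  have "adj (v + l) (v + l + l)"
  proof (rule deg_tight2[of ?S _ _ "n - l"])
    fix f assume f: "0 < f" "f < n" "adj (v + l) (v + l + f)"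
    then show "f \<in> ?S" using cap_neighbours[OF cap sn nb nf _ _ ls, of l f] s kl l3 by auto
  next
    show "int (card ?S) \<le> k + l" using card_Un2[of "{1..l}" "{n-l..n-1}"] lk l3 by (auto split: if_splits)
    have "\<not> E v (v + l)" using eq_ban[OF kl _ E_left n] by blast
    moreover have "\<not> E (v + l) v" using no_bwd_cases[OF nb, of "v + l" v] s by auto
    moreover have "v + l + (n - l) = v + n" by simp
    ultimately show "\<not> adj (v + l) (v + l + (n - l))" by (simp only: adj_per) (simp add: adj_def)
  qed (use l3 n in auto)
  moreover have "\<not> E (v + l + l) (v + l)" using no_bwd_cases[OF nb, of "v + l + l" "v + l"] s by auto
  ultimately have "E (v + l) (v + l + l)" by (simp add: adj_def)
  then show False using eq_ban[OF kl E1 _ n] by (simp add: add.commute)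
qed

lemma outside: "v + P + f = v - (n - P - f) + n" for P f by simp

text \<open>These are \<open>2 * l - 1\<close> offsets, so none is vacant; \<open>n - s - 1\<close>
  belongs to the vertex \<open>v - (l - 1)\<close> outside the cap.\<close>

lemma m_tight:
  assumes f: "f \<in> {1..l-2} \<union> {n-l..n-1} \<union> {n-s-1}"
  shows "adj (v + (d + 1)) (v + (d + 1) + f)"
proof (rule deg_tight[OF _ _ _ f])
  let ?S = "{1..l-2} \<union> {n-l..n-1} \<union> {n-s-1}"
  show "int (card ?S) \<le> k + l - 1"
    using card_Un3[of "{1..l-2}" "{n-l..n-1}" "{n-s-1}"] lk l3 by (auto split: if_splits)
  fix f assume f: "0 < f" "f < n" "adj (v + (d + 1)) (v + (d + 1) + f)"
  define T where "T = n - (d + 1) - f"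
  have a: "E (v + (d + 1)) (v - T) \<or> E (v - T) (v + (d + 1))"
    using f(3) by (simp only: outside T_def[symmetric] adj_per) (auto simp: adj_def)
  show "f \<in> ?S"
  proof (cases "1 \<le> T \<and> T < n - s")
    case True
    then show ?thesis using a
    proof (elim disjE)
      assume E: "E (v + (d + 1)) (v - T)"
      have "T = l - 2 \<Longrightarrow> s = l" using m_l2 E ls by fastforce
      then show ?thesis using m_out[OF _ _ E] True d f by (auto simp: T_def)
    qed (use m_in[of T] True d f in \<open>auto simp: T_def\<close>)
  next
    case False then show ?thesis using f d by (auto simp: T_def)
  qed
qed simp

lemma adj_m1: "adj (v - 1) (v + (d + 1))"
proof -
  have "adj (v + (d + 1)) (v - 1 + n)"
    by (rule adj_eq[OF m_tight[of "n - d - 2"]]) (use d in auto)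
  then show ?thesis by (simp add: adj_commute)
qed

lemma E_m: "E (v + (d + 1)) (v - (l - 1) + n)"
proof -
  have "adj (v + (d + 1)) (v - (l - 1) + n)"
    by (rule adj_eq[OF m_tight[of "n - s - 1"]]) (use d in auto)
  then show ?thesis using m_in[of "l - 1"] d wide by (auto simp: adj_def)
qed

text \<open>The configuration of \<open>case_mid\<close> with \<open>adj_m1\<close>, which reaches
  one position further into the cap and so gains one arc.\<close>

lemma d': "2 * d \<le> l - 3"
proof (rule ccontr)
  assume H: "\<not> 2 * d \<le> l - 3"
  have "adj (v - 1 + n) (v + (d + 1) + n)" using adj_m1 by simp
  moreover have "adj (v + l - 1) (v + s + 1)" using adj_cap_ends small l3 by auto
  ultimately show False
    using cross3[OF cap_n, of "v + l - 1" "v + s + 1" "v - 1 + n" "v + (d + 1) + n", unfolded ok_def]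
      wide d kl lk H by auto
qed

lemma adj_m': "1 \<le> j \<Longrightarrow> j \<le> l - 2 \<Longrightarrow> adj (v + (d + 1)) (v + (d + 1) + j)"
  by (rule m_tight) auto

lemma wide': "l + 3 \<le> n - s"
proof -
  have "E (v + s) (v + s + (n - s))" using cap_n by simp
  moreover have "\<not> E (v + s) (v + s + (l + 2))" by (rule eq_no_l2[OF kl]) (use wide ls d d' in auto)
  ultimately have "n - s \<noteq> l + 2" by metis
  then show ?thesis using wide by simp
qed

lemma m2_out:
  assumes T: "1 \<le> T" "T < n - s" and E: "E (v + (d + 2)) (v - T)"
  shows "T + d + 2 < l \<or> T = l - 1"
proof (rule ccontr)
  assume H: "\<not> ?thesis"
  have "T \<le> l - 1" using far_T(1)[OF adj_m1, of "d + 2" T] T E d by auto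
  then have "l - 3 \<le> T" "T \<le> l - 2" using no_bwd_cases[OF nb E] H d by auto
  moreover have "E (v + (d + 2)) (v - T + n)" using E by simp
  ultimately show False using cross2[OF E_m, of "v + (d + 2)" "v - T + n", unfolded ok_def] wide' d kl lk by auto
qed

lemma m2_in:
  assumes T: "1 \<le> T" "T < n - s" and E: "E (v - T) (v + (d + 2))"
  shows "T + d + 2 \<le> l"
proof (rule ccontr)
  assume H: "\<not> T + d + 2 \<le> l"
  define x where "x = T + d + 2"
  define y where "y = v - T"
  have Tl: "T \<le> l" using far_T(2)[OF adj_m1, of "d + 2" T] T E d by auto
  have E': "E y (y + x)" by (rule E_eq[OF E]) (auto simp: x_def y_def)
  have "2 * l + 2 \<le> n" using wide ls by simp
  then have "x \<noteq> l + 2" using eq_no_l2[OF kl] E' d d' by auto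
  moreover have "x \<noteq> l + 1" using no_l1 E' by blast
  ultimately have x: "l + 3 \<le> x" using H by (simp add: x_def)
  have xs: "x \<le> s + 3" using Tl d by (simp add: x_def)
  have J: "adj (y + x - 1) (y + x - 1 + j)" if "1 \<le> j" "j \<le> l - 2" for j
    by (rule adj_eq[OF adj_m'[of j]]) (use that in \<open>auto simp: x_def y_def\<close>)
  note near = eq_near_tail[OF kl E' _ _ _ _ J, of _ "l - 2"]
  have "k + l - 1 \<le> int (card ({1..x-1} \<union> {n-2..n-1}))"
  proof (rule degS[of _ "y + 1"])
    fix f assume f: "0 < f" "f < n" "adj (y + 1) (y + 1 + f)"
    then show "f \<in> {1..x-1} \<union> {n-2..n-1}" using near[of 1 f] x xs wide' by force
  qed simp
  then have "2 * l - 2 \<le> x" using card_Un2[of "{1..x-1}" "{n-2..n-1}"] x lk l1 by (auto split: if_splits)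
  \<comment> \<open>The count at \<open>y + 1\<close> fails to contradict only for these numbers;
    there the count at \<open>y + 2\<close> decides.\<close>
  then have "l = 5" using xs small d d' by linarith
  then have "s = 5" using d d' by linarith
  then have "x = 8" using xs \<open>2 * l - 2 \<le> x\<close> \<open>l = 5\<close> by linarith
  have "d = 1" unfolding d_def using \<open>l = 5\<close> \<open>s = 5\<close> by simp
  have "T = 5" using \<open>d = 1\<close> \<open>x = 8\<close> by (simp add: x_def)
  note num = \<open>l = 5\<close> \<open>s = 5\<close> \<open>x = 8\<close> \<open>d = 1\<close> \<open>T = 5\<close>
  have "k + l - 1 \<le> int (card ({1..5} \<union> {n-3..n-1}))"
  proof (rule degS[of _ "y + 2"])
    fix f assume f: "0 < f" "f < n" "adj (y + 2) (y + 2 + f)"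
    have "\<not> E (y + 2 + 6) (y + 2)"
    proof
      assume H: "E (y + 2 + 6) (y + 2)"
      have "E (v + (d + 2)) (v - 3)" by (rule E_eq[OF H]) (simp_all add: y_def \<open>d = 1\<close> \<open>T = 5\<close>)
      then show False using m2_out[of 3] wide num d(1) by auto
    qed
    then have "f \<noteq> 6" using no_l1[of "y + 2"] f num by (auto simp: adj_def)
    then show "f \<in> {1..5} \<union> {n-3..n-1}" using near[of 2 f] f num wide' by force
  qed simp
  then show False using card_Un2[of "{1..5}" "{n-3..n-1}"] num lk by (auto split: if_splits)
qed

text \<open>At \<open>v + d + 2\<close> only \<open>2 * l - 2\<close> offsets remain, one short of
  the degree.\<close>

lemma case_small: False
proof -
  let ?S = "{1..l-3} \<union> {n-l..n-1} \<union> {n-s-2}"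
  have "k + l - 1 \<le> int (card ?S)"
  proof (rule degS[of _ "v + (d + 2)"])
    fix f assume f: "0 < f" "f < n" "adj (v + (d + 2)) (v + (d + 2) + f)"
    define T where "T = n - (d + 2) - f"
    have a: "E (v + (d + 2)) (v - T) \<or> E (v - T) (v + (d + 2))"
      using f(3) by (simp only: outside T_def[symmetric] adj_per) (auto simp: adj_def)
    then show "f \<in> ?S"
      using m2_out[of T] m2_in[of T] f d d' by (cases "1 \<le> T \<and> T < n - s") (auto simp: T_def)
  qed simp
  then show False using card_Un3[of "{1..l-3}" "{n-l..n-1}" "{n-s-2}"] lk d d' by (auto split: if_splits)
qed

end

lemma no_eqcap: False
proof -
  consider "2 * l - 1 \<le> s" | "s = 2 * l - 2" | "3 * l - 3 \<le> 2 * s" "s \<le> 2 * l - 3" | "2 * s \<le> 3 * l - 4"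
    by linarith
  then show False using case_far case_2l2 case_mid case_small by cases auto
qed

end

context hcyc begin

lemma case_eq:
  assumes kl: "k \<le> l" and n: "2 * l + 1 \<le> n"
  shows False
proof -
  have l3: "3 \<le> l" using kl kl6 lk by simp
  then have "l < n" using n by simp
  then show False
  proof (cases rule: extremal[of l "l + 1"])
    case (1 s i)
    interpret eqcap A V k l n c i s by unfold_locales (use 1 kl n in auto)
    show False by (rule no_eqcap)
  next
    case (2 x i)
    have "x \<noteq> l + 1" using no_chord_Suc_l[of i] 2 n l3 kl lk by (auto simp: add.assoc)
    then show False using eq_no_fwd[OF kl 2(3) _ 2(2) 2(4) 2(5) n] 2(1) by auto
  qed
qed

section \<open>Moving a vertex, and the case \<open>n = k + l + 1\<close>\<close>

lemma shift: "hcyc A V k l n (\<lambda>i. c (i + t))"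
proof
  show "c (i + n + t) = c (i + t)" for i using per[of "i + t"] by (simp add: algebra_simps)
  show "A (c (i + t)) (c (i + 1 + t))" for i using cyc[of "i + t"] by (simp add: algebra_simps)
  have "(\<lambda>i. c (i + t)) ` {0..<n} = V"
  proof safe
    fix v assume "v \<in> V"
    then obtain i where "t \<le> i" "i < t + n" "v = c i" using V_c[of v t] by auto
    then show "v \<in> (\<lambda>i. c (i + t)) ` {0..<n}" by (intro image_eqI[of _ _ "i - t"]) auto
  qed (use cV in auto)
  moreover have "inj_on (\<lambda>i. c (i + t)) {0..<n}"
  proof (rule inj_onI)
    fix i j assume "i \<in> {0..<n}" "j \<in> {0..<n}" "c (i + t) = c (j + t)"
    then show "i = j" using c_window[of t "i + t" "j + t"] by auto
  qed
  ultimately show "bij_betw (\<lambda>i. c (i + t)) {0..<n} V" unfolding bij_betw_def by simp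
qed (use l1 lk kl6 AV deg nomem n0 in auto)

lemma shift_E: "hcyc.E A (\<lambda>i. c (i + t)) i j = E (i + t) (j + t)"
  using hcyc.E_def[OF shift] E_def by simp

text \<open>The cyclic order in which vertex 0 has been moved between \<open>j\<close> and \<open>j + 1\<close>.\<close>

definition mv :: "int \<Rightarrow> int \<Rightarrow> int" where
  "mv j p = (let i = p mod n in if i < j then i + 1 else if i = j then 0 else i)"

lemma mv: "0 \<le> i \<Longrightarrow> i < n \<Longrightarrow> mv j i = (if i < j then i + 1 else if i = j then 0 else i)"
  by (simp add: mv_def)

lemma mv_n: "mv j (i + n) = mv j i" by (simp add: mv_def)

text \<open>The arc over vertex 0 closes the gap that it leaves; its arcs with \<open>j\<close> and
  \<open>j + 1\<close> take it in again.\<close>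

lemma move:
  assumes "E (- 1) 1" "E j 0" "E 0 (j + 1)" "1 \<le> j" "j \<le> n - 2"
  shows "hcyc A V k l n (\<lambda>i. c (mv j i))"
proof
  show "c (mv j (i + n)) = c (mv j i)" for i by (simp add: mv_n)
  have n1: "E (n - 1) 1" "E (n - 1) 0" using assms(1) E_per(1)[of "- 1" 1] E_cyc[of "n - 1"] E_per(2)[of "n - 1" 0] by auto
  have *: "E (mv j i) (mv j (i + 1))" if i: "0 \<le> i" "i < n" for i
  proof (cases "i = n - 1")
    case True
    then have "mv j (i + 1) = 1" using mv_n[of j 0] mv[of 0 j] assms n0 by simp
    moreover have "mv j i = n - 1" using True mv[of i j] i assms by simp
    ultimately show ?thesis using n1 by simp
  next
    case False
    then show ?thesis using mv[of i j] mv[of "i + 1" j] i assms E_cyc[of i] E_cyc[of "i + 1"]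
      by (auto simp: add.assoc simp del: E_cyc)
  qed
  have "mv j i = mv j (i mod n)" "mv j (i + 1) = mv j (i mod n + 1)" for i
    by (auto simp: mv_def mod_add_left_eq)
  then show "A (c (mv j i)) (c (mv j (i + 1)))" for i
    using *[of "i mod n"] n0 by (simp add: E_def)
  have inj: "inj_on (mv j) {0..<n}"
    by (rule inj_onI) (use assms in \<open>auto simp: mv split: if_splits\<close>)
  have "mv j ` {0..<n} \<subseteq> {0..<n}" using assms by (auto simp: mv split: if_splits)
  then have "mv j ` {0..<n} = {0..<n}" using inj by (intro endo_inj_surj) auto
  then have "bij_betw (mv j) {0..<n} {0..<n}" using inj by (simp add: bij_betw_def)
  then show "bij_betw (\<lambda>i. c (mv j i)) {0..<n} V"
    using bij_betw_trans[OF _ bij] by (simp add: o_def)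
qed (use l1 lk kl6 AV deg nomem n0 in auto)

lemma move_E:
  assumes "hcyc A V k l n (\<lambda>i. c (mv j i))"
  shows "hcyc.E A (\<lambda>i. c (mv j i)) a b = E (mv j a) (mv j b)"
  using hcyc.E_def[OF assms] E_def by simp

section \<open>Traversing a segment of the cycle backwards\<close>

definition cover :: "int \<Rightarrow> int \<Rightarrow> bool" where
  "cover m a \<longleftrightarrow> (\<exists>xs. xs \<noteq> [] \<and> successively E xs \<and> distinct xs \<and> hd xs = a \<and> last xs = a - m \<and> set xs = {a - m..a})"

lemma cover_add:
  assumes "cover m a" "cover p (a - m)" "0 < m" "0 < p"
  shows "cover (m + p) a"
proof -
  obtain xs where xs: "xs \<noteq> []" "successively E xs" "distinct xs" "hd xs = a" "last xs = a - m" "set xs = {a - m..a}"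
    using assms(1) by (auto simp: cover_def)
  obtain ys where ys: "ys \<noteq> []" "successively E ys" "distinct ys" "hd ys = a - m" "last ys = a - m - p" "set ys = {a - m - p..a - m}"
    using assms(2) by (auto simp: cover_def)
  obtain zs where zs: "ys = (a - m) # zs" using ys(1,4) by (cases ys) auto
  have "zs \<noteq> []" using ys(5) zs assms(4) by auto
  have setz: "set zs = {a - m - p..a - m} - {a - m}" using ys(3,6) zs by auto
  show ?thesis unfolding cover_def
  proof (rule exI[of _ "xs @ zs"], intro conjI)
    show "successively E (xs @ zs)" using xs ys(2) zs \<open>zs \<noteq> []\<close> by (auto simp: succ_app successively_Cons)
    show "distinct (xs @ zs)" using xs ys(3) zs setz by auto
    show "set (xs @ zs) = {a - (m + p)..a}" using xs(6) setz assms by auto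
  qed (use xs ys zs \<open>zs \<noteq> []\<close> assms in auto)
qed

text \<open>The rest of the cycle also leads from \<open>a\<close> to \<open>a - m\<close>, with
  \<open>n - m\<close> arcs.\<close>

lemma cover_contra:
  assumes "cover m a" "0 < m" "m < n" and ok: "ok m (n - m)"
  shows False
proof -
  obtain xs where xs: "xs \<noteq> []" "successively E xs" "distinct xs" "hd xs = a" "last xs = a - m" "set xs = {a - m..a}"
    using assms(1) by (auto simp: cover_def)
  have len: "int (length xs) = m + 1" using distinct_card[OF xs(3)] xs(6) assms(2) by simp
  have "E (a - m + n - 1) (a - m)" using E_cyc[of "a - m - 1"] E_per(1)[of "a - m - 1"] by (simp add: algebra_simps)
  then show False
    by (intro config[of xs "[a..a - m + n - 1] @ [a - m]" "a - m", OF _ _ _ _ _ _ _ _ _ _ _ ok])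
      (use assms xs len in \<open>auto simp: succ_simps\<close>)
qed

lemma cover3:
  assumes "\<And>i. a - 3 \<le> i \<Longrightarrow> i \<le> a - 2 \<Longrightarrow> E (i + 2) i"
  shows "cover 3 a"
  unfolding cover_def
  by (rule exI[of _ "[a, a - 2, a - 1, a - 3]"])
    (use assms[of "a - 2"] assms[of "a - 3"] E_cyc[of "a - 2"] in auto)

lemma cover5:
  assumes "\<And>i. a - 5 \<le> i \<Longrightarrow> i \<le> a - 2 \<Longrightarrow> E (i + 2) i" "adj (a - 4) (a - 1)"
  shows "cover 5 a"
proof (cases "E (a - 1) (a - 4)")
  case True then show ?thesis
  unfolding cover_def
  by (intro exI[of _ "[a, a - 2, a - 1, a - 4, a - 3, a - 5]"])
    (use assms(1)[of "a - 2"] assms(1)[of "a - 5"] E_cyc[of "a - 2"] E_cyc[of "a - 4"] in auto)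
next
  case False then show ?thesis
  unfolding cover_def
  by (intro exI[of _ "[a, a - 2, a - 4, a - 1, a - 3, a - 5]"])
    (use assms(2) assms(1)[of "a - 2"] assms(1)[of "a - 4"] assms(1)[of "a - 3"] assms(1)[of "a - 5"] in \<open>auto simp: adj_def\<close>)
qed

text \<open>The admissible \<open>m\<close> are the sums of threes and fives. The value 10 is
  separate because 7 is no such sum.\<close>

lemma cover_all:
  assumes "\<And>i. a - m \<le> i \<Longrightarrow> i \<le> a - 2 \<Longrightarrow> E (i + 2) i" "\<And>i. adj i (i + 3)"
    and "m \<in> {3, 5, 6} \<or> 8 \<le> m"
  shows "cover m a"
  using assms(1,3)
proof (induction "nat m" arbitrary: m a rule: less_induct)
  case less
  have c3: "cover 3 b" if "b \<le> a" "a - m \<le> b - 3" for b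
    by (rule cover3) (use that less(2) in auto)
  have c5: "cover 5 b" if "b \<le> a" "a - m \<le> b - 5" for b
    by (rule cover5) (use that less(2) assms(2)[of "b - 4"] in auto)
  consider "m = 3" | "m = 5" | "m = 10" | "m - 3 \<in> {3, 5, 6} \<or> 8 \<le> m - 3" using less(3) by force
  then show ?case
  proof cases
    case 3 then show ?thesis using cover_add[of 5 a 5] c5[of a] c5[of "a - 5"] by simp
  next
    case 4
    have "cover (m - 3) (a - 3)" by (rule less(1)) (use 4 less(2) in auto)
    then show ?thesis using cover_add[of 3 a "m - 3"] c3[of a] 4 by auto
  qed (use c3[of a] c5[of a] in auto)
qed

lemma K_not_both:
  assumes "2 \<le> l" "k + l < n" "E (v + l + 1) v" "adj v (v + l)" "adj (v - 1) (v - 1 + l)"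
  shows False
  using chords2[of v] chords3[of v] assms by (auto simp: adj_def algebra_simps)

text \<open>Each vertex misses at most one other. By \<open>K_not_both\<close>, pairs of span
  \<open>l\<close> from consecutive vertices are not both adjacent, and since a vertex cannot miss
  two others, adjacency of these pairs alternates. They account for all missing pairs.\<close>

lemma alternating:
  assumes l2: "2 \<le> l" and kl: "l + 2 \<le> k" and n: "n = k + l + 1"
  shows "E (i + l + 1) i" and "odd l" and "f \<noteq> l \<Longrightarrow> f \<noteq> n - l \<Longrightarrow> 0 < f \<Longrightarrow> f < n \<Longrightarrow> adj i (i + f)"
    and "\<not> adj i (i + l) \<longleftrightarrow> adj (i + 1) (i + 1 + l)"
proof -
  have n': "k + l < n" using n by simp
  have miss: "f = g" if "\<not> adj i (i + f)" "\<not> adj i (i + g)" "0 < f" "f < n" "0 < g" "g < n" for i f g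
    using deg_tight2[of "{1..n-1}" i f g] that n lk l1 by auto
  have bk: "adj i (i - f) = adj i (i + (n - f))" for i f
    using adj_per(4)[of i "i + (n - f)"] by (simp add: algebra_simps)
  have A1: "\<not> E v (v + l + 1)" for v using no_chord_Suc_l[of v] l2 n by simp
  have K: "adj v (v + l + 1)" for v
  proof (rule ccontr)
    assume "\<not> adj v (v + l + 1)"
    \<comment> \<open>A missing pair of span \<open>l + 1\<close> would spread round the cycle, and
      \<open>v\<close> would miss both \<open>v + l + 1\<close> and \<open>v + k\<close>.\<close>
    have "\<not> adj (v + int j) (v + int j + l + 1)" for j
    proof (induction j)
      case 0 then show ?case using \<open>\<not> adj v (v + l + 1)\<close> by simp
    next
      case (Suc j)
      let ?v = "v + int j"
      have a: "\<not> adj ?v (?v + (l + 1))" using Suc by (simp add: add.assoc)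
      have b: "\<not> adj (?v + l + 1) (?v + l + 1 - (l + 1))" using Suc by (simp add: adj_commute)
      have "adj ?v (?v + l)" using miss[OF a, of l] n lk l2 by auto
      moreover have "adj (?v + l + 1) (?v + l + 1 - l)"
        using miss[OF b[unfolded bk], of "n - l"] n lk l2 bk[of "?v + l + 1" l] by auto
      ultimately show ?case using K_not_both[of "?v + 1"] A1[of "?v + 1"] l2 n'
        by (auto simp: adj_def algebra_simps)
    qed
    note r = this
    have "\<not> adj (v + k) (v + k + l + 1)" using r[of "nat k"] lk l1 by simp
    moreover have "v + k + l + 1 = v + n" using n by simp
    ultimately have "\<not> adj v (v + (l + 1))" "\<not> adj (v + k) v" using r[of 0] by (simp_all add: add.assoc)
    then have "l + 1 = k" using miss[of v "l + 1" k] n lk l1 by (simp add: adj_commute)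
    then show False using n kl by simp
  qed
  then have Ki: "E (v + l + 1) v" for v using A1[of v] by (auto simp: adj_def)
  show "E (i + l + 1) i" by (rule Ki)
  define a where "a i \<longleftrightarrow> \<not> adj i (i + l)" for i
  have a1: "a v \<or> a (v + 1)" for v using K_not_both[of "v + 1"] Ki[of "v + 1"] l2 n' by (auto simp: a_def)
  have a2: "\<not> a (v + l)" if "a v" for v
  proof
    assume "a (v + l)"
    then have "\<not> adj (v + l) (v + l + l)" "\<not> adj (v + l) (v + l + (n - l))"
      using that by (auto simp: a_def adj_commute)
    then show False using miss[of "v + l" l "n - l"] n kl l2 by auto
  qed
  have a3: "a v \<longleftrightarrow> \<not> a (v + 1)" for v
  proof
    assume "a v"
    then have "a (v + 1 + l)" using a1[of "v + l"] a2[of v] by (auto simp: algebra_simps)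
    then show "\<not> a (v + 1)" using a2[of "v + 1"] by blast
  qed (use a1 in blast)
  then show "\<not> adj i (i + l) \<longleftrightarrow> adj (i + 1) (i + 1 + l)" by (simp add: a_def)
  have alt: "a (v + int j) \<longleftrightarrow> (even j \<longleftrightarrow> a v)" for v j
  proof (induction j)
    case (Suc j)
    then show ?case using a3[of "v + int j"] by (auto simp: algebra_simps)
  qed simp
  have ex: "\<exists>v. a v" using a1 by blast
  show odd: "odd l" using ex a2 alt[of _ "nat l"] l2 by (auto simp: even_nat_iff)
  have a4: "a v \<or> a (v - l)" for v using alt[of "v - l" "nat l"] odd l2 by (auto simp: even_nat_iff)
  show "f \<noteq> l \<Longrightarrow> f \<noteq> n - l \<Longrightarrow> 0 < f \<Longrightarrow> f < n \<Longrightarrow> adj i (i + f)"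
  proof (rule ccontr)
    assume *: "f \<noteq> l" "f \<noteq> n - l" "0 < f" "f < n" "\<not> adj i (i + f)"
    have "\<not> adj i (i + l) \<or> \<not> adj i (i + (n - l))" using a4[of i] bk[of i l] by (auto simp: a_def adj_commute)
    then show False using miss[OF *(5), of l] miss[OF *(5), of "n - l"] *(1-4) n lk l2 by auto
  qed
qed

text \<open>Moving vertex 0 turns two consecutive pairs of span \<open>l\<close> across its old
  place into pairs of span \<open>l - 1\<close>. Those are adjacent in the new cycle, against the
  alternation in the old one.\<close>

lemma no_fwd2:
  assumes l2: "2 \<le> l" and kl: "l + 2 \<le> k" and n: "n = k + l + 1"
  shows "\<not> E (- 1) 1"
proof
  assume E1: "E (- 1) 1"
  note S = alternating[OF l2 kl n]
  have l3: "3 \<le> l" using S(2) l2 by (cases "l = 2") auto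
  have "\<not> E 0 (l + 1)" using no_chord_Suc_l[of 0] l2 n by simp
  moreover have "E 0 k" using S(1)[of k] n E_per(1)[of 0 k] by simp
  ultimately obtain j where j: "l + 1 \<le> j" "j < k" "\<not> E 0 j" "E 0 (j + 1)"
    using int_switch[of "l + 1" k "E 0"] kl by auto
  have "E j 0" using S(3)[of j 0] j n l1 by (auto simp: adj_def)
  then have hm: "hcyc A V k l n (\<lambda>i. c (mv j i))" using move[OF E1 _ j(4)] j n l1 by auto
  interpret R: hcyc A V k l n "\<lambda>i. c (mv j i)" by (rule hm)
  have *: "adj i (i + l)" if "i = - 1 \<or> i = - 2" for i
  proof -
    have "R.adj (i + l - 1) (i + l - 1 + (n - l + 1))"
      by (rule R.alternating(3)[OF l2 kl n]) (use n kl l2 in auto)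
    moreover have "i + l - 1 + (n - l + 1) = i + n" by simp
    moreover have "mv j (i + l - 1) = i + l" "mv j (i + n) = i + n"
      using mv[of "i + l - 1" j] mv[of "i + n" j] that j l3 n by auto
    ultimately have "adj (i + l) (i + n)" by (simp only: R.adj_def move_E[OF hm] adj_def)
    then show ?thesis by (simp add: adj_commute)
  qed
  show False using *[of "- 1"] *[of "- 2"] S(4)[of "- 2"] by simp
qed

lemma case_succ_n:
  assumes l2: "2 \<le> l" and kl: "l + 2 \<le> k" and n: "n = k + l + 1"
  shows False
proof -
  note S = alternating[OF l2 kl n]
  have l3: "3 \<le> l" using S(2) l2 by (cases "l = 2") auto
  have b2: "E (i + 2) i" for i
  proof -
    interpret R: hcyc A V k l n "\<lambda>j. c (j + (i + 1))" by (rule shift)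
    have "\<not> E i (i + 2)" using R.no_fwd2[OF assms, unfolded shift_E] by (simp add: add.commute)
    then show ?thesis using S(3)[of 2 i] n l3 kl by (auto simp: adj_def)
  qed
  show False
  proof (cases "l = 3")
    case True
    then show False using cover_contra[of l 0, unfolded ok_def] cover3[of 0] b2 n kl by auto
  next
    case False
    then have "5 \<le> l" using l3 S(2) by (cases "l = 4") auto
    \<comment> \<open>Here \<open>k\<close> may be 7, which is no sum of threes and fives;
      \<open>k + 1\<close> is at least 8 and still leaves \<open>l\<close> arcs to the other
      path.\<close>
    then have "cover (k + 1) 0" by (intro cover_all) (use b2 S(3)[of 3] n kl in auto)
    then show False using cover_contra[of "k + 1" 0, unfolded ok_def] n l2 kl by auto
  qed
qed

section \<open>The case \<open>n = k + l\<close>\<close>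

lemma all_adj: "n = k + l \<Longrightarrow> 0 < f \<Longrightarrow> f < n \<Longrightarrow> adj i (i + f)"
  using deg_tight[of "{1..n-1}" i f] lk l1 by auto

lemma all_adj0: "n = k + l \<Longrightarrow> 0 < f \<Longrightarrow> f < n \<Longrightarrow> E 0 f \<or> E f 0"
  using all_adj[of f 0] by (simp add: adj_def)

lemma per_ind:
  assumes "P a" "\<And>i. P i \<Longrightarrow> P (i - 1)" "\<And>i. P (i + n) = P i"
  shows "P (i :: int)"
proof -
  have down: "P (a - int j)" for j
  proof (induction j)
    case (Suc j)
    have "a - int (Suc j) = a - int j - 1" by simp
    then show ?case using assms(2)[OF Suc] by (simp only:)
  qed (simp add: assms(1))
  have per: "P (i - int q * n) = P i" for q
  proof (induction q)
    case (Suc q)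
    have "i - int (Suc q) * n + n = i - int q * n" by (simp add: algebra_simps)
    then show ?case using assms(3)[of "i - int (Suc q) * n"] Suc by (simp only:)
  qed simp
  define q where "q = nat (i - a)"
  have "i - int q * n \<le> a"
  proof (cases "a \<le> i")
    case True
    then have "(i - a) * 1 \<le> (i - a) * n" using n0 by (intro mult_left_mono) auto
    then show ?thesis using True by (simp add: q_def)
  qed (simp add: q_def)
  then have "P (i - int q * n)" using down[of "nat (a - (i - int q * n))"] by simp
  then show ?thesis by (simp add: per)
qed

section \<open>Directions of the chords when the underlying graph is complete\<close>

definition orient :: "int \<Rightarrow> bool" where "orient m \<longleftrightarrow> (\<forall>i. E i (i + m) \<and> \<not> E (i + m) i)"

lemma no_bwd1: "l \<le> 1 \<Longrightarrow> n = k + l \<Longrightarrow> \<not> E (i + 1) i"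
proof
  assume l: "l \<le> 1" and n: "n = k + l" and E: "E (i + 1) i"
  have "ok k l" by (simp add: ok_def)
  have "E (i + n - 1) i" using E_cyc[of "i - 1"] E_per(1)[of "i - 1" i] by (simp add: algebra_simps)
  then show False
    by (intro config[of "[i + 1..i + n - 1] @ [i]" "[i + 1, i]" i, OF _ _ _ _ _ _ _ _ _ _ _ \<open>ok k l\<close>])
      (use E n l l1 lk kl6 in \<open>auto simp: succ_simps\<close>)
qed

text \<open>For \<open>l > 1\<close>, a backward chord of span \<open>l\<close> at \<open>a\<close>
  and a forward one at \<open>a + 1\<close> give paths of lengths \<open>l\<close> and
  \<open>k\<close>. Hence one forward chord makes all of them forward; if all point backwards, the
  chords of span \<open>k\<close> are forward.\<close>

lemma typ_ex:
  assumes n: "n = k + l"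
  shows "orient l \<or> orient k"
proof (cases "l \<le> 1")
  case True
  then have "l = 1" using l1 by simp
  then show ?thesis using no_bwd1[OF True n] by (simp add: orient_def)
next
  case l2: False
  have dich: "\<not> E (a + l) a" if "E (a + 1) (a + 1 + l)" for a
  proof
    assume "E (a + l) a"
    then have "E (a + l) (a + n)" by simp
    then show False
      using cross1[of "a + 1" "a + 1 + l" "a + l" "a + n", unfolded ok_def] that n l2 lk kl6 by auto
  qed
  have D: "E a (a + l) \<or> E (a + l) a" for a using all_adj[OF n, of l a] lk l2 n by (auto simp: adj_def)
  show ?thesis
  proof (cases "\<exists>a. E a (a + l)")
    case True
    then obtain a where a: "E a (a + l)" by blast
    have all: "E i (i + l)" for i
    proof (rule per_ind[of "\<lambda>i. E i (i + l)" a])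
      show "E i (i + l) \<Longrightarrow> E (i - 1) (i - 1 + l)" for i using dich[of "i - 1"] D[of "i - 1"] by auto
      show "E (i + n) (i + n + l) = E i (i + l)" for i
        using E_per(2)[of i "i + l"] by (simp add: algebra_simps)
    qed (rule a)
    then show ?thesis using dich by (auto simp: orient_def)
  next
    case False
    have "E i (i + k) = E i (i - l)" "E (i + k) i = E (i - l) i" for i
      using E_per(2)[of i "i - l"] E_per(1)[of "i - l" i] n by (simp_all add: algebra_simps)
    moreover have F: "\<not> E (i - l) i" for i using False by (metis diff_add_cancel)
    moreover have "E i (i - l)" for i using D[of "i - l"] F[of i] by simp
    ultimately have "orient k" by (simp add: orient_def)
    then show ?thesis by simp
  qed
qed

lemma typ_l: "n = k + l \<Longrightarrow> orient l \<Longrightarrow> E i (i + l)" by (simp add: orient_def)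

lemma typ_k: "n = k + l \<Longrightarrow> orient k \<Longrightarrow> \<not> E i (i + l)"
proof -
  assume "n = k + l" "orient k"
  then have "\<not> E (i + l + k) (i + l)" "i + l + k = i + n" by (auto simp: orient_def)
  then show ?thesis by simp
qed

text \<open>Here \<open>cross2\<close> gives paths of lengths \<open>m\<close> and
  \<open>n - m\<close>, that is \<open>k\<close> and \<open>l\<close> in some order.\<close>

lemma no_consec:
  assumes "n = k + l" "m = l \<or> m = k" "m + 2 \<le> n" "E a (a + m + 1)" "E (a + 1) (a + m + 2)"
  shows False
  using cross2[OF assms(4,5), unfolded ok_def] assms l1 lk by auto

lemma kl_succ: "n = k + l \<Longrightarrow> k = l + 1 \<Longrightarrow> \<not> orient k"
proof
  assume n: "n = k + l" and kl: "k = l + 1" and "orient k"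
  then have "E 0 (0 + (l + 1))" "E 1 (1 + (l + 1))" unfolding orient_def by blast+
  then show False using no_consec[OF n, of l 0] kl l1 kl6 n by (auto simp: add.commute)
qed

lemma kl_eq: "n = k + l \<Longrightarrow> k \<noteq> l"
proof
  assume n: "n = k + l" and kl: "k = l"
  then have "orient k" "orient l" using typ_ex[OF n] by auto
  then show False using typ_l[OF n, of 0] typ_k[OF n, of 0] by simp
qed

text \<open>Two paths from \<open>i + 3\<close> to \<open>i + n + 2\<close> that visit all vertices:
  one reaches \<open>i + n + 1\<close> by a chord of span \<open>m\<close>, the other jumps over it
  by the chord of span 2.\<close>

lemma fwd2_typ:
  assumes n: "n = k + l" and m: "m = l \<or> m = k" "orient m" "2 \<le> m" "2 \<le> n - m" and E: "E i (i + 2)"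
  shows "\<not> E (i + 3) (i + 2 - m)"
proof
  assume H: "E (i + 3) (i + 2 - m)"
  have ok: "ok (n - m) m" using n m(1) by (auto simp: ok_def)
  have "E (i + 3) (i + 2 - m + n)" "E (i + n) (i + 2 + n)" using H E by simp_all
  then have "E (i + 3) (i + 2 - m + n)" "E (i + n) (i + n + 2)" by (simp_all only: ac_simps)
  moreover have "E (i + 1 + (n - m)) (i + 1 + (n - m) + m)" using m(2) unfolding orient_def by blast
  then have "E (i + 1 + n - m) (i + n + 1)" by (rule E_eq) auto
  moreover have "E (i + n + 1) (i + n + 2)" by (rule E_eq[OF E_cyc[of "i + n + 1"]]) simp_all
  ultimately show False
    by (intro config[of "[i + 3..i + 1 + n - m] @ [i + n + 1, i + n + 2]" "[i + 3] @ [i + 2 - m + n..i + n] @ [i + n + 2]" "i + 3",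
        OF _ _ _ _ _ _ _ _ _ _ _ ok])
      (use m in \<open>auto simp: succ_simps\<close>)
qed

text \<open>Otherwise vertex 0 can be moved, and chords of span \<open>m\<close> of the new cycle are two
  consecutive chords of span \<open>m + 1\<close> of the old one.\<close>

lemma fwd2_step:
  assumes n: "n = k + l" and l3: "3 \<le> l" and kl: "l + 1 \<le> k" and E1: "E (- 1) 1"
  shows "E 0 2"
proof (rule ccontr)
  assume "\<not> E 0 2"
  then have E2: "E 2 0" using all_adj0[OF n, of 2] n l3 lk by auto
  obtain m where m: "m = l \<or> m = k" "orient m" using typ_ex[OF n] by blast
  have mb: "3 \<le> m" "m \<le> n - 3" using m n l3 lk by auto
  have "\<not> E m 0" using m(2) unfolding orient_def by (metis add_0)
  then obtain j where j: "2 \<le> j" "j < m" "E j 0" "\<not> E (j + 1) 0"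
    using int_switch[of 2 m "\<lambda>j. \<not> E j 0"] E2 mb by auto
  have "E 0 (j + 1)" using all_adj0[OF n, of "j + 1"] j mb by auto
  then have hm: "hcyc A V k l n (\<lambda>i. c (mv j i))" using move[OF E1 j(3)] j mb by auto
  interpret R: hcyc A V k l n "\<lambda>i. c (mv j i)" by (rule hm)
  note ME = move_E[OF hm]
  \<comment> \<open>The move keeps the type: unless \<open>k = l + 1\<close>, where only
    \<open>orient l\<close> is possible, some chord of span \<open>l\<close> is shared by both
    cycles.\<close>
  have "R.orient m"
  proof (cases "k = l + 1")
    case True
    then show ?thesis using kl_succ[OF n] R.kl_succ[OF n] R.typ_ex[OF n] m by auto
  next
    case False
    have "\<exists>p t. R.E p (p + l) = E t (t + l)"
    proof (cases "l + 1 \<le> j")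
      case True
      then have "R.E 0 (0 + l) = E 1 (1 + l)" unfolding ME using mv[of 0 j] mv[of l j] l3 j mb n by (simp add: add.commute)
      then show ?thesis by blast
    next
      case f: False
      have e: "n - 1 - l + l = n - 1" by simp
      have "R.E (n - 1 - l) (n - 1 - l + l) = E (n - 1 - l) (n - 1 - l + l)"
        unfolding ME e using f mv[of "n - 1 - l" j] mv[of "n - 1" j] l3 j mb n False kl by simp
      then show ?thesis by blast
    qed
    then show ?thesis
      using m typ_ex[OF n] typ_l[OF n] typ_k[OF n] R.typ_ex[OF n] R.typ_l[OF n] R.typ_k[OF n] by metis
  qed
  have F: "E x (x + m + 1)" if "j + 1 \<le> x" "n - m \<le> x" "x < n" "x < n - m + j" for x
  proof -
    have "R.E x (x + m)" using \<open>R.orient m\<close> by (simp add: R.orient_def)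
    moreover have "mv j x = x" using mv[of x j] that j by auto
    moreover have "mv j (x + m) = x + m + 1 - n" using mv[of "x + m - n" j] mv_n[of j "x + m - n"] that mb by auto
    ultimately show ?thesis unfolding ME by simp
  qed
  \<comment> \<open>From \<open>x\<close> and from \<open>x + 1\<close> a chord of span
    \<open>m\<close> wraps round and ends before the place of insertion, so it has span
    \<open>m + 1\<close> in the old cycle.\<close>
  define x where "x = max (j + 1) (n - m)"
  have "E x (x + m + 1)" "E (x + 1) (x + 1 + m + 1)" by (rule F; use j mb in \<open>auto simp: x_def\<close>)+
  then show False using no_consec[OF n m(1), of x] mb by (simp add: algebra_simps)
qed

text \<open>One forward chord of span 2 makes all of them forward. Then \<open>fwd2_typ\<close>
  turns all chords of span \<open>m + 1\<close> forward, against \<open>no_consec\<close>.\<close>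

lemma bwd2_all:
  assumes n: "n = k + l" and l2: "2 \<le> l" and kl: "l + 1 \<le> k"
  shows "E (i + 2) i"
proof (rule ccontr)
  assume "\<not> E (i + 2) i"
  then have E: "E i (i + 2)" using all_adj[OF n, of 2 i] l2 n kl by (auto simp: adj_def)
  obtain m where m: "m = l \<or> m = k" "orient m" using typ_ex[OF n] by blast
  have all: "E j (j + 2)" for j
  proof (cases "3 \<le> l")
    case True
    have up: "E (a + 1) (a + 3)" if "E a (a + 2)" for a
    proof -
      interpret R: hcyc A V k l n "\<lambda>i. c (i + (a + 1))" by (rule shift)
      show ?thesis using R.fwd2_step[OF n True kl, unfolded shift_E] that by (simp add: algebra_simps)
    qed
    show ?thesis
    proof (rule ccontr)
      assume H: "\<not> E j (j + 2)"
      have "\<not> E i (i + 2)"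
      proof (rule per_ind[of "\<lambda>i. \<not> E i (i + 2)", OF H])
        show "\<not> E i (i + 2) \<Longrightarrow> \<not> E (i - 1) (i - 1 + 2)" for i using up[of "i - 1"] by (auto simp: algebra_simps)
        show "(\<not> E (i + n) (i + n + 2)) = (\<not> E i (i + 2))" for i
          using E_per(2)[of i "i + 2"] by (simp add: algebra_simps)
      qed
      then show False using E by blast
    qed
  next
    case False
    then have l: "l = 2" using l2 by simp
    show ?thesis
    proof (cases "m = l")
      case True then show ?thesis using m(2) l by (simp add: orient_def)
    next
      case False then show ?thesis using typ_k[OF n, of i] m E l by simp
    qed
  qed
  have "E j (j + m + 1)" for j
  proof -
    have "\<not> E (j + m - 2 + 3) (j + m - 2 + 2 - m)"
      by (rule fwd2_typ[OF n m _ _ all]) (use m n l2 kl in auto)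
    then have "\<not> E (j + (m + 1)) j" by (simp add: algebra_simps)
    moreover have "adj j (j + (m + 1))" by (rule all_adj[OF n]) (use m n l2 kl in auto)
    ultimately show ?thesis by (simp add: adj_def add.assoc)
  qed
  from this[of 0] this[of 1] show False using no_consec[OF n m(1), of 0] m n l2 kl by (auto simp: algebra_simps)
qed

text \<open>Move vertex 0 between \<open>j\<close> and \<open>j + 1\<close>: it is skipped in the new cycle, too.\<close>

lemma skip_switch:
  assumes l: "l \<le> 1" and n: "n = k + l" and E1: "E (- 1) 1"
    and j: "2 \<le> j" "j \<le> n - 3" "E j 0" "E 0 (j + 1)"
  shows "\<not> E (j - 1) 0" "\<not> E 0 (j + 2)"
proof -
  have hm: "hcyc A V k l n (\<lambda>i. c (mv j i))" using move[OF E1 j(3,4)] j by auto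
  interpret R: hcyc A V k l n "\<lambda>i. c (mv j i)" by (rule hm)
  note ME = move_E[OF hm]
  have cons: "\<not> (R.E a (a + 2) \<and> R.E (a + 1) (a + 3))" for a
    using R.no_consec[OF n, of l a] l l1 n lk kl6 by (auto simp: algebra_simps)
  have m: "mv j (j - 2) = j - 1" "mv j (j - 1) = j" "mv j j = 0" "mv j (j + 1) = j + 1" "mv j (j + 2) = j + 2"
    using j by (auto simp: mv)
  have "R.E (j - 1) (j + 1)" unfolding ME m by simp
  then have "\<not> R.E (j - 2) j" "\<not> R.E j (j + 2)" using cons[of "j - 2"] cons[of "j - 1"] by (auto simp: algebra_simps)
  then show "\<not> E (j - 1) 0" "\<not> E 0 (j + 2)" unfolding ME m by auto
qed

lemma skip_parity0:
  assumes l: "l \<le> 1" and n: "n = k + l" and E1: "E (- 1) 1"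
  shows "odd n" and "1 \<le> f \<Longrightarrow> f < n \<Longrightarrow> E f 0 \<longleftrightarrow> even f"
proof -
  note sw = skip_switch[OF assms]
  have n6: "6 \<le> n" using n kl6 by simp
  have cons: "\<not> (E a (a + 2) \<and> E (a + 1) (a + 3))" for a
    using no_consec[OF n, of l a] l l1 n6 by (auto simp: algebra_simps)
  have "\<not> E 0 2" "\<not> E (n - 2) 0" using cons[of "- 1"] cons[of "- 2"] E1 E_per(1)[of "- 2" 0] by auto
  then have En: "E 0 (n - 2)" and E2: "E 2 0" using all_adj0[OF n, of "n - 2"] all_adj0[OF n, of 2] n6 by auto
  have step: "E 0 (e + 1) \<and> \<not> E (e - 1) 0 \<and> \<not> E 0 (e + 2)" if e: "2 \<le> e" "e \<le> n - 3" "E e 0" for e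
  proof -
    have "E 0 (e + 1)"
    proof (rule ccontr)
      assume H: "\<not> E 0 (e + 1)"
      \<comment> \<open>If the direction does not change right after \<open>e\<close>,
        \<open>skip_switch\<close> forbids a change at every later position, but 0 has an arc to
        \<open>n - 2\<close>.\<close>
      have "e + 1 \<le> j \<Longrightarrow> j \<le> n - 2 \<longrightarrow> \<not> E 0 j \<and> E (j - 1) 0" for j
      proof (induction j rule: int_ge_induct)
        case base then show ?case using H e by simp
      next
        case (step j)
        show ?case
        proof
          assume j: "j + 1 \<le> n - 2"
          then have IH: "\<not> E 0 j" "E (j - 1) 0" using step by auto
          then have "E j 0" using all_adj0[OF n, of j] j step(1) e by auto
          then show "\<not> E 0 (j + 1) \<and> E (j + 1 - 1) 0" using sw(1)[of j] IH j step(1) e by auto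
        qed
      qed
      from this[of "n - 2"] show False using En e by auto
    qed
    then show ?thesis using sw[of e] e by auto
  qed
  have ev: "2 * int i + 2 < n \<Longrightarrow> E (2 * int i + 2) 0 \<and> \<not> E 0 (2 * int i + 2)" for i
  proof (induction i)
    case 0 then show ?case using E2 \<open>\<not> E 0 2\<close> by simp
  next
    case (Suc i)
    have "\<not> E 0 (2 * int i + 2 + 2)" using step[of "2 * int i + 2"] Suc by auto
    moreover have "2 * int i + 2 + 2 = 2 * int (Suc i) + 2" by simp
    ultimately have "\<not> E 0 (2 * int (Suc i) + 2)" by simp
    then show ?case using all_adj0[OF n, of "2 * int (Suc i) + 2"] Suc(2) by auto
  qed
  have ev': "E e 0 \<and> \<not> E 0 e" if "even e" "2 \<le> e" "e < n" for e
  proof -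
    have "2 * int (nat (e div 2 - 1)) + 2 = e" using that by auto
    then show ?thesis using ev[of "nat (e div 2 - 1)"] that by simp
  qed
  show odd: "odd n" using ev'[of "n - 2"] En n6 by auto
  show "E f 0 \<longleftrightarrow> even f" if f: "1 \<le> f" "f < n"
  proof (cases "even f")
    case True then show ?thesis using ev'[of f] f by (cases "f = 1") auto
  next
    case False
    have "\<not> E f 0"
    proof (cases "f = n - 2")
      case True then show ?thesis using \<open>\<not> E (n - 2) 0\<close> by simp
    next
      case f': False
      have "f \<noteq> n - 1" using odd False by auto
      moreover have "f \<noteq> n - 3" using odd False by presburger
      ultimately have "f + 1 \<le> n - 3" using f f' by simp
      then show ?thesis using step[of "f + 1"] ev'[of "f + 1"] False f by auto
    qed
    then show ?thesis using False by simp
  qed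
qed

lemma skip_parity:
  assumes l: "l \<le> 1" and n: "n = k + l" and E1: "E (t - 1) (t + 1)" and f: "1 \<le> f" "f < n"
  shows "E (t + f) t \<longleftrightarrow> even f"
proof -
  interpret R: hcyc A V k l n "\<lambda>i. c (i + t)" by (rule shift)
  show ?thesis using R.skip_parity0(2)[OF l n _ f, unfolded shift_E] E1 by (simp add: add.commute)
qed

text \<open>Moving vertex 0 changes the parity of the distance of another vertex from \<open>t\<close>.\<close>

lemma skip_unique:
  assumes l: "l \<le> 1" and n: "n = k + l" and E1: "E (- 1) 1" and t: "2 \<le> t" "t \<le> n - 2"
  shows "\<not> E (t - 1) (t + 1)"
proof
  assume Et: "E (t - 1) (t + 1)"
  note P = skip_parity0[OF l n E1]
  have "6 \<le> n" using n kl6 by simp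
  then have n7: "7 \<le> n" using P(1) by (cases "n = 6") auto
  show False
  \<comment> \<open>Vertex 0 is put back on the side of \<open>t\<close> where \<open>t - 1\<close>,
    \<open>t\<close>, \<open>t + 1\<close> stay consecutive, so \<open>t\<close> is skipped in the
    new cycle too.\<close>
  proof (cases "4 \<le> t")
    case True
    have "E 2 0" "E 0 3" using P(2)[of 2] P(2)[of 3] all_adj0[OF n, of 3] n7 by auto
    then have hm: "hcyc A V k l n (\<lambda>i. c (mv 2 i))" using move[OF E1, of 2] n7 by auto
    interpret R: hcyc A V k l n "\<lambda>i. c (mv 2 i)" by (rule hm)
    have m: "mv 2 (t - 1) = t - 1" "mv 2 t = t" "mv 2 (t + 1) = t + 1" "mv 2 (t + (n - t)) = 1"
      using mv[of _ 2] mv_n[of 2 0] True t n7 by auto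
    have "R.E (t + (n - t)) t \<longleftrightarrow> even (n - t)"
      by (rule R.skip_parity[OF l n]) (use Et t in \<open>auto simp only: move_E[OF hm] m\<close>)
    then have "E 1 t \<longleftrightarrow> even (n - t)" unfolding move_E[OF hm] m .
    moreover have e: "t + (n - t + 1) = 1 + n" by simp
    have "E (t + (n - t + 1)) t \<longleftrightarrow> even (n - t + 1)"
      by (rule skip_parity[OF l n Et]) (use t in auto)
    then have "E 1 t \<longleftrightarrow> even (n - t + 1)" unfolding e by (simp only: E_per)
    ultimately show False by (cases "even n"; cases "even t"; simp)
  next
    case False
    let ?j = "n - 3"
    have "E ?j 0" "E 0 (?j + 1)" using P(1) P(2)[of ?j] P(2)[of "?j + 1"] all_adj0[OF n, of "?j + 1"] n7 by auto
    then have hm: "hcyc A V k l n (\<lambda>i. c (mv ?j i))" using move[OF E1, of ?j] n7 by auto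
    interpret R: hcyc A V k l n "\<lambda>i. c (mv ?j i)" by (rule hm)
    have m: "mv ?j (t - 1 - 1) = t - 1" "mv ?j (t - 1) = t" "mv ?j (t - 1 + 1) = t + 1" "mv ?j (t - 1 + (n - t)) = n - 1"
      using mv[of _ ?j] False t n7 by auto
    have "R.E (t - 1 + (n - t)) (t - 1) \<longleftrightarrow> even (n - t)"
      by (rule R.skip_parity[OF l n]) (use Et t in \<open>auto simp only: move_E[OF hm] m\<close>)
    then have "E (n - 1) t \<longleftrightarrow> even (n - t)" unfolding move_E[OF hm] m .
    moreover have "E (t + (n - t - 1)) t \<longleftrightarrow> even (n - t - 1)"
      by (rule skip_parity[OF l n Et]) (use t in auto)
    then have "E (n - 1) t \<longleftrightarrow> even (n - t - 1)" by simp
    ultimately show False by (cases "even n"; cases "even t"; simp)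
  qed
qed

text \<open>All other chords of span 2 point backwards, which suffices to traverse the
  \<open>k\<close> arcs ending at 0. As \<open>n = k + 1\<close> is odd, \<open>k\<close> is not the
  exceptional value 7.\<close>

lemma no_skip:
  assumes l: "l \<le> 1" and n: "n = k + l"
  shows "\<not> E (- 1) 1"
proof
  assume E1: "E (- 1) 1"
  have k: "5 \<le> k" "n = k + 1" using n l l1 kl6 by auto
  have "cover k 0"
  proof (rule cover_all)
    show "k \<in> {3, 5, 6} \<or> 8 \<le> k" using skip_parity0(1)[OF l n E1] k by (cases "k = 7") auto
    show "adj i (i + 3)" for i by (rule all_adj[OF n]) (use k in auto)
    fix i assume i: "0 - k \<le> i" "i \<le> 0 - 2"
    have "\<not> E i (i + 2)"
    proof (cases "i = - 2")
      case True
      then show ?thesis using no_consec[OF n, of l "- 2"] E1 l l1 k by auto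
    next
      case False
      then show ?thesis using skip_unique[OF l n E1, of "i + 1 + n"] i k E_per(2)[of i "i + 2"] E_per(1)[of i "i + 2 + n"]
        by (simp add: algebra_simps)
    qed
    moreover have "adj i (i + 2)" by (rule all_adj[OF n]) (use k in auto)
    ultimately show "E (i + 2) i" by (simp add: adj_def)
  qed
  then show False using cover_contra[of k 0, unfolded ok_def] n k l1 by auto
qed

lemma bwd2_all_l1:
  assumes l: "l \<le> 1" and n: "n = k + l"
  shows "E (i + 2) i"
proof -
  interpret R: hcyc A V k l n "\<lambda>j. c (j + (i + 1))" by (rule shift)
  have "\<not> E i (i + 2)" using R.no_skip[OF l n, unfolded shift_E] by (simp add: add.commute)
  moreover have "adj i (i + 2)" by (rule all_adj[OF n]) (use n kl6 in auto)
  ultimately show ?thesis by (simp add: adj_def)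
qed

section \<open>The exceptional values of \<open>k\<close> and \<open>l\<close>\<close>

lemma cover7:
  assumes b2: "\<And>i. E (i + 2) i" and "E (a - 3) (a - 6)" "adj (a - 4) (a - 1)"
  shows "cover 7 a"
proof (cases "E (a - 1) (a - 4)")
  case True then show ?thesis
  unfolding cover_def
  by (intro exI[of _ "[a, a - 2, a - 1, a - 4, a - 3, a - 6, a - 5, a - 7]"])
    (use assms(2) b2[of "a - 2"] b2[of "a - 7"] E_cyc[of "a - 2"] E_cyc[of "a - 4"] E_cyc[of "a - 6"] in auto)
next
  case False then show ?thesis
  unfolding cover_def
  by (intro exI[of _ "[a, a - 2, a - 4, a - 1, a - 3, a - 6, a - 5, a - 7]"])
    (use assms(2,3) b2[of "a - 2"] b2[of "a - 4"] b2[of "a - 3"] b2[of "a - 7"] E_cyc[of "a - 6"] in \<open>auto simp: adj_def\<close>)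
qed

text \<open>A backward chord of span 3 makes seven arcs traversable. Without one, all chords of span
  3 point forwards, which determines enough arcs for explicit paths.\<close>

lemma complete_k7:
  assumes n: "n = k + l" and k: "k = 7" and l: "l \<in> {1, 2, 4}" and b2: "\<And>i. E (i + 2) i"
  shows False
proof (cases "\<exists>i. E (i + 3) i")
  case True
  then obtain i where i: "E (i + 3) i" by blast
  have "adj (i + 6 - 4) (i + 6 - 1)" by (rule adj_eq[OF all_adj[OF n, of 3 "i + 2"]]) (use n k l1 in auto)
  moreover have "E (i + 6 - 3) (i + 6 - 6)" using i by (simp add: add.commute)
  ultimately have "cover 7 (i + 6)" by (intro cover7[OF b2])
  then show False using cover_contra[of 7 "i + 6", unfolded ok_def] n k l by auto
next
  case False
  have f3: "E i (i + 3)" for i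
    using all_adj[OF n, of 3 i] False n k l1 by (auto simp: adj_def)
  have b2': "E (i + n) (i + n - 2)" for i using b2[of "i + n - 2"] by simp
  have w: "E 0 (n - 2)" "E 1 (n - 1)" using b2'[of 0] b2'[of 1] E_per(1)[of 0 "n - 2"] by simp_all
  have ok: "ok 7 l" unfolding ok_def using k by simp
  have c: "E 0 1" "E 1 2" "E 2 3" "E 3 4" "E 4 5" "E 5 6" "E 6 7" "E 7 8"
    using E_cyc[of 0] E_cyc[of 1] E_cyc[of 2] E_cyc[of 3] E_cyc[of 4] E_cyc[of 5] E_cyc[of 6] E_cyc[of 7] by simp_all
  have b: "E 10 8" "E 9 7" "E 8 6" "E 7 5" "E 6 4" "E 5 3" "E 4 2"
    using b2[of 8] b2[of 7] b2[of 6] b2[of 5] b2[of 4] b2[of 3] b2[of 2] by simp_all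
  have f: "E 3 6" "E 4 7" "E 5 8" using f3[of 3] f3[of 4] f3[of 5] by simp_all
  from l consider "l = 1" | "l = 2" | "l = 4" by blast
  then show False
  proof cases
    case 1
    show False
      by (rule config[of "[0,1,2,3,4,7,5,6]" "[0,6]" 0, OF _ _ _ _ _ _ _ _ _ _ _ ok])
        (use w c b f n k 1 in auto)
  next
    case 2
    show False
      by (rule config[of "[0,1,2,3,6,4,5,8]" "[0,7,8]" 0, OF _ _ _ _ _ _ _ _ _ _ _ ok])
        (use w c b f n k 2 in auto)
  next
    case 3
    show False
      by (rule config[of "[0,1,10,8,6,4,2,3]" "[0,9,7,5,3]" 0, OF _ _ _ _ _ _ _ _ _ _ _ ok])
        (use w c b f n k 3 in auto)
  qed
qed

text \<open>Every choice of directions for the three diagonals of the hexagon contains one of the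
  five excluded pairs.\<close>

lemma complete_42:
  assumes n: "n = k + l" and k: "k = 4" and l: "l = 2" and b2: "\<And>i. E (i + 2) i"
  shows False
proof -
  have n6: "n = 6" using n k l by simp
  have ok: "ok 4 2" unfolding ok_def using k l by simp
  have c: "E 0 1" "E 1 2" "E 2 3" "E 3 4" "E 4 5" "E 5 0"
    using E_cyc[of 0] E_cyc[of 1] E_cyc[of 2] E_cyc[of 3] E_cyc[of 4] E_cyc[of 5] E_per(2)[of 5 0] n6 by simp_all
  have b: "E 0 4" "E 1 5" "E 5 3" "E 4 2" "E 3 1" "E 2 0"
    using b2[of 4] b2[of 5] b2[of 3] b2[of 2] b2[of 1] b2[of 0] E_per(1)[of 0 4] E_per(1)[of 1 5] n6 by simp_all
  have cf: False if "successively E xs" "successively E ys" "distinct xs" "distinct ys" "hd xs = hd ys" "last xs = last ys"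
    "hd xs \<noteq> last xs" "set xs \<inter> set ys \<subseteq> {hd xs, last xs}" "set xs \<union> set ys \<subseteq> {0..<6}" "length xs = 5" "length ys = 3" for xs ys
    by (rule config[of xs ys 0, OF that(1-4) _ _ that(5-8) _ ok]) (use that n6 in auto)
  have "\<not> (E 3 0 \<and> E 5 2)" using cf[of "[3,0,1,5,2]" "[3,4,2]"] c b by auto
  moreover have "\<not> (E 2 5 \<and> E 4 1)" using cf[of "[2,5,0,4,1]" "[2,3,1]"] c b by auto
  moreover have "\<not> (E 1 4 \<and> E 3 0)" using cf[of "[1,4,2,3,0]" "[1,5,0]"] c b by auto
  moreover have "\<not> (E 0 3 \<and> E 5 2)" using cf[of "[0,3,1,5,2]" "[0,4,2]"] c b by auto
  moreover have "\<not> (E 0 3 \<and> E 2 5)" using cf[of "[0,3,1,2,5]" "[0,4,5]"] c b by auto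
  moreover have "adj 0 3" "adj 1 4" "adj 2 5"
    using all_adj[OF n, of 3 0] all_adj[OF n, of 3 1] all_adj[OF n, of 3 2] n6 by auto
  ultimately show False by (auto simp: adj_def)
qed

lemma case_complete:
  assumes n: "n = k + l"
  shows False
proof -
  have kl: "l + 1 \<le> k" using kl_eq[OF n] lk by simp
  have b2: "E (i + 2) i" for i
    using bwd2_all[OF n _ kl, of i] bwd2_all_l1[OF _ n, of i] by linarith
  have a3: "adj i (i + 3)" for i by (rule all_adj[OF n]) (use n kl6 in auto)
  have big: False if "m = k \<or> m = l" "m \<in> {3, 5, 6} \<or> 8 \<le> m" for m
    using cover_contra[of m 0, unfolded ok_def] cover_all[of 0 m, OF b2 a3 that(2)] that n l1 lk by auto
  have "k \<notin> {3, 5, 6} \<and> k < 8" "l \<notin> {3, 5, 6} \<and> l < 8" using big by force+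
  then have "k = 7 \<and> l \<in> {1, 2, 4} \<or> k = 4 \<and> l = 2" using kl l1 kl6 by auto
  then show False using complete_k7[OF n _ _ b2] complete_42[OF n _ _ b2] by blast
qed

lemma contradiction: False
proof -
  consider "n = k + l" | "k + l < n" "l \<le> 1" | "k + l < n" "2 \<le> l" "k \<le> l" | "k + l < n" "2 \<le> l" "k = l + 1"
    | "n = k + l + 1" "2 \<le> l" "l + 2 \<le> k" | "k + l + 2 \<le> n" "2 \<le> l" "l + 2 \<le> k"
    using n_ge lk by linarith
  then show False
  proof cases
    case 1 then show False by (rule case_complete)
  next
    case 2 then show False using case_l1 l1 by auto
  next
    case 3 then show False using case_eq lk by auto
  next
    case 4 then show False using case_succ kl6 by auto
  next
    case 5 then show False using case_succ_n by blast
  next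
    case 6 then show False using case_main by blast
  qed
qed

end

section \<open>Digraphs\<close>

lemma (in wf_digraph) successively_awalk_verts:
  "awalk u p v \<Longrightarrow> successively (dominates G) (awalk_verts u p)"
proof (induction p arbitrary: u)
  case (Cons e es)
  then have "awalk (head G e) es v" "tail G e = u" "e \<in> arcs G" by (auto simp: awalk_Cons_iff)
  moreover have "hd (awalk_verts (head G e) es) = head G e" using \<open>awalk (head G e) es v\<close>
    by (cases es) (auto simp: awalk_Cons_iff)
  moreover have "successively (dominates G) (awalk_verts (head G e) es)" by (rule Cons.IH) fact
  ultimately show ?case by (cases "awalk_verts (head G e) es") (auto simp: in_arcs_imp_in_arcs_ends)
qed simp

lemma (in wf_digraph) awalk_of_successively:
  assumes "successively (dominates G) xs" "xs \<noteq> []" "set xs \<subseteq> verts G"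
  shows "\<exists>p. awalk (hd xs) p (last xs) \<and> awalk_verts (hd xs) p = xs \<and> length xs = length p + 1"
  using assms
proof (induction xs)
  case (Cons x xs)
  show ?case
  proof (cases "xs = []")
    case True then show ?thesis using Cons.prems by (intro exI[of _ "[]"]) (auto simp: awalk_Nil_iff)
  next
    case False
    then obtain p where p: "awalk (hd xs) p (last xs)" "awalk_verts (hd xs) p = xs" "length xs = length p + 1"
      using Cons by (auto simp: successively_Cons)
    obtain e where "e \<in> arcs G" "tail G e = x" "head G e = hd xs"
      using Cons.prems False by (auto simp: successively_Cons elim: reachableE)
    then show ?thesis using p False by (intro exI[of _ "e # p"]) (auto simp: awalk_Cons_iff)
  qed
qed simp

lemma (in wf_digraph) successively_in_verts:
  "successively (dominates G) xs \<Longrightarrow> 2 \<le> length xs \<Longrightarrow> set xs \<subseteq> verts G"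
proof (induction xs rule: induct_list012)
  case (3 x y zs)
  then show ?case by (cases zs) (auto dest: adj_in_verts)
qed auto

lemma (in wf_digraph) arc_inner_verts:
  assumes "awalk u p v" "2 \<le> length p" "e \<in> set p"
  shows "tail G e \<in> set (inner_verts p) \<or> head G e \<in> set (inner_verts p)"
proof -
  obtain a b r where p: "p = a # b # r" using assms(2) by (cases p; cases "tl p") auto
  then have "head G a = tail G b" using assms(1) by (auto simp: awalk_Cons_iff)
  then show ?thesis using assms(3) p by (auto simp: inner_verts_def)
qed

lemma (in digraph) C_family_of_two_paths:
  assumes "two_paths (dominates G) (int k) (int l)" "2 \<le> k" "1 \<le> l"
  shows "\<exists>H. subgraph H G \<and> H \<in> C_family k l"
proof -
  obtain xs ys where xy: "xs \<noteq> []" "ys \<noteq> []" "successively (dominates G) xs" "successively (dominates G) ys"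
    "distinct xs" "distinct ys" "hd xs = hd ys" "last xs = last ys" "hd xs \<noteq> last xs"
    "set xs \<inter> set ys = {hd xs, last xs}" "k < length xs" "l < length ys"
    using assms(1) unfolding two_paths_def by auto
  have V: "set xs \<subseteq> verts G" "set ys \<subseteq> verts G"
    using successively_in_verts[OF xy(3)] successively_in_verts[OF xy(4)] xy(11,12) assms by auto
  obtain p where p: "awalk (hd xs) p (last xs)" "awalk_verts (hd xs) p = xs" "length xs = length p + 1"
    using awalk_of_successively[OF xy(3,1) V(1)] by blast
  obtain q where q: "awalk (hd xs) q (last xs)" "awalk_verts (hd xs) q = ys" "length ys = length q + 1"
    using awalk_of_successively[OF xy(4,2) V(2)] xy(7,8) by auto
  have ap: "apath (hd xs) p (last xs)" "apath (hd xs) q (last xs)"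
    using p q xy by (simp_all add: apath_def)
  have ip: "set (inner_verts p) = set xs - {hd xs, last xs}" "set (inner_verts q) = set ys - {hd xs, last xs}"
    using set_inner_verts[OF ap(1)] set_inner_verts[OF ap(2)] p q by auto
  have inV: "tail G e \<in> set (awalk_verts u r)" "head G e \<in> set (awalk_verts u r)" if "awalk u r v" "e \<in> set r" for u r v e
    using set_awalk_verts[OF that(1)] that(2) by auto
  \<comment> \<open>As \<open>p\<close> has at least two arcs, each of its arcs has an end that is
    an inner vertex of \<open>p\<close> and hence not on \<open>q\<close>.\<close>
  have disj: "set p \<inter> set q = {}"
  proof (rule ccontr)
    assume "set p \<inter> set q \<noteq> {}"
    then obtain e where e: "e \<in> set p" "e \<in> set q" by blast
    then show False
      using arc_inner_verts[OF p(1) _ e(1)] inV[OF p(1) e(1)] inV[OF q(1) e(2)] p q ip xy assms(2) by auto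
  qed
  define H where "H = G \<lparr> verts := set xs \<union> set ys, arcs := set p \<union> set q \<rparr>"
  have H: "verts H = set xs \<union> set ys" "arcs H = set p \<union> set q" "tail H = tail G" "head H = head G"
    by (simp_all add: H_def)
  have adj_cap_ends: "set p \<subseteq> arcs G" "set q \<subseteq> arcs G" using p(1) q(1) by (auto simp: awalk_def)
  have wf: "wf_digraph H" using inV[OF p(1)] inV[OF q(1)] p q by unfold_locales (auto simp: H)
  have dH: "digraph H"
  proof -
    interpret H: wf_digraph H by (rule wf)
    show ?thesis
      by unfold_locales (use no_loops no_multi_arcs adj_cap_ends in \<open>auto simp: H arc_to_ends_def subset_iff\<close>)
  qed
  have comp: "compatible G H" by (simp add: compatible_def H)
  have sub: "subgraph H G" unfolding subgraph_def
    using V adj_cap_ends wf comp wf_digraph by (auto simp: H)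
  note cc = compatible_cas[OF comp, symmetric] compatible_awalk_verts[OF comp, symmetric]
  have apH: "pre_digraph.apath H (hd xs) p (last xs)" "pre_digraph.apath H (hd xs) q (last xs)"
    using ap xy unfolding pre_digraph.apath_def pre_digraph.awalk_def cc by (auto simp: H)
  have iH: "pre_digraph.inner_verts H r = inner_verts r" for r by (simp add: pre_digraph.inner_verts_def H)
  have "H \<in> C_family k l" unfolding C_family_def
  proof (rule CollectI, rule conjI[OF dH], rule exI[of _ "hd xs"], rule exI[of _ "last xs"],
      rule exI[of _ p], rule exI[of _ q], intro conjI)
    show "k \<le> length p" "l \<le> length q" using p q xy by auto
    show "set (pre_digraph.inner_verts H p) \<inter> set (pre_digraph.inner_verts H q) = {}"
      unfolding iH ip using xy(10) by blast
    show "verts H = set (pre_digraph.awalk_verts H (hd xs) p) \<union> set (pre_digraph.awalk_verts H (hd xs) q)"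
      unfolding cc p(2) q(2) by (rule H(1))
  qed (rule xy(9) apH disj H(2))+
  then show ?thesis using sub by blast
qed

text \<open>Arcs of the symmetric closure are pairs of vertices, so opposite arcs are merged and the
  out-degree counts each neighbour once.\<close>

lemma (in digraph) min_degree_symmetric_le:
  assumes "v \<in> verts G"
  shows "min_degree (with_proj (mk_symmetric G)) \<le> card {u. dominates G v u \<or> dominates G u v}"
proof -
  let ?S = "with_proj (mk_symmetric G)"
  have "out_arcs ?S v = Pair v ` {u. dominates G v u \<or> dominates G u v}"
    by (auto simp: out_arcs_def parcs_mk_symmetric arcs_ends_conv)
  then have "out_degree ?S v = card {u. dominates G v u \<or> dominates G u v}"
    by (simp add: out_degree_def card_image inj_on_def)
  then show ?thesis unfolding min_degree_def using assms by (metis Min_le finite_imageI finite_verts imageI pverts_mk_symmetric with_proj_simps(1))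
qed

lemma (in wf_digraph) hamiltonian_list:
  assumes "hamiltonian"
  obtains vs where "vs \<noteq> []" "distinct vs" "set vs = verts G"
    "\<And>i. i < length vs \<Longrightarrow> dominates G (vs ! i) (vs ! (Suc i mod length vs))"
proof -
  obtain p u where p: "awalk u p u" "distinct (tl (awalk_verts u p))" "p \<noteq> []" "tail G ` set p = verts G"
    using assms unfolding hamiltonian_def cycle_def by auto
  define vs where "vs = map (tail G) p"
  have "vs \<noteq> []" using p by (simp add: vs_def)
  have aw: "awalk_verts u p = vs @ [u]" using p(1,3) by (simp add: awalk_verts_conv vs_def awalk_conv)
  have hd: "vs ! 0 = u" using p(1,3) by (cases p) (auto simp: vs_def awalk_Cons_iff)
  have "distinct vs" using p(2) hd \<open>vs \<noteq> []\<close> unfolding aw by (cases vs) auto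
  moreover have "dominates G (vs ! i) (vs ! (Suc i mod length vs))" if "i < length vs" for i
  proof -
    have "dominates G ((vs @ [u]) ! i) ((vs @ [u]) ! Suc i)"
      using successively_awalk_verts[OF p(1)] that unfolding aw successively_conv_nth by simp
    then show ?thesis using that hd by (cases "Suc i = length vs") (auto simp: nth_append)
  qed
  moreover have "set vs = verts G" using p by (simp add: vs_def)
  ultimately show thesis using that \<open>vs \<noteq> []\<close> by blast
qed

theorem theorem1p6:
  fixes D :: "('a, 'b) pre_digraph" and k l :: nat
  assumes "l \<le> k" and "1 \<le> l" and "6 \<le> k + l"
    and "digraph D"
    and "pre_digraph.hamiltonian D"
    and "k + l - 1 \<le> min_degree (with_proj (mk_symmetric D))"
  shows "\<exists>H. subgraph H D \<and> H \<in> C_family k l"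
proof (rule ccontr)
  assume none: "\<not> (\<exists>H. subgraph H D \<and> H \<in> C_family k l)"
  interpret digraph D by (rule assms(4))
  obtain vs where vs: "vs \<noteq> []" "distinct vs" "set vs = verts D"
    "\<And>i. i < length vs \<Longrightarrow> dominates D (vs ! i) (vs ! (Suc i mod length vs))"
    using hamiltonian_list[OF assms(5)] by metis
  define n where "n = int (length vs)"
  define c where "c i = vs ! nat (i mod n)" for i
  have n0: "0 < n" using vs(1) by (simp add: n_def)
  have "hcyc (dominates D) (verts D) (int k) (int l) n c"
  proof
    show "u \<in> verts D \<and> v \<in> verts D \<and> u \<noteq> v" if "dominates D u v" for u v
      using that adj_in_verts adj_not_same by blast
    show "int k + int l - 1 \<le> int (card {u. dominates D v u \<or> dominates D u v})" if "v \<in> verts D" for v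
      using min_degree_symmetric_le[OF that] assms(3,6) by linarith
    show "\<not> two_paths (dominates D) (int k) (int l)"
      using C_family_of_two_paths[of k l] none assms(1-3) by auto
    show "c (i + n) = c i" for i by (simp add: c_def)
    have "bij_betw (\<lambda>i. vs ! nat i) {0..<n} (set vs)"
    proof (rule bij_betw_trans[of nat _ "{..<length vs}" "(!) vs", unfolded o_def])
      show "bij_betw nat {0..<n} {..<length vs}"
        by (rule bij_betw_byWitness[of _ int]) (auto simp: n_def)
      show "bij_betw ((!) vs) {..<length vs} (set vs)" by (rule bij_betw_nth[OF vs(2)]) auto
    qed
    then show "bij_betw c {0..<n} (verts D)"
      unfolding vs(3) by (rule bij_betw_cong[THEN iffD1, rotated]) (auto simp: c_def)
    show "dominates D (c i) (c (i + 1))" for i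
    proof -
      have i: "0 \<le> i mod n" "i mod n < n" using n0 by auto
      have "(i + 1) mod n = (i mod n + 1) mod n" by (simp add: mod_add_left_eq)
      then have "nat ((i + 1) mod n) = Suc (nat (i mod n)) mod length vs"
        using i by (simp add: n_def nat_mod_distrib Suc_nat_eq_nat_zadd1 add.commute)
      then show ?thesis using vs(4)[of "nat (i mod n)"] i by (simp add: c_def n_def)
    qed
  qed (use assms n0 in auto)
  then show False by (rule hcyc.contradiction)
qed

end
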